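(* Let $1\le q\le\infty$, and let $1<p<t<r<\infty$ or $1<p\le t<r=\infty$. Then the Hardy-Littlewood maximal operator $\mathcal M$ is bounded on $M_{p,q}^{t,r}(\mathbb R^n)$.
   Context: Hardy-Littlewood maximal operator: $\mathcal Mf(x)=\sup_{B\ni x}\frac1{|B|}\int_B|f(y)|\,dy$, supremum over all balls $B\subset\mathbb R^n$ containing $x$. Lorentz norm: with $d_f(s)=|\{x:|f(x)|>s\}|$ and $f^*(u)=\inf\{s>0:d_f(s)\le u\}$, $\|f\|_{L^{p,q}}=\left(\int_0^\infty(u^{1/p}f^*(u))^q\frac{du}{u}\right)^{1/q}$ for $q<\infty$ and $\|f\|_{L^{p,\infty}}=\sup_{u>0}u^{1/p}f^*(u)$. For a cube $Q$, $\|f\|_{L^{p,q}(Q)}=\|f\chi_Q\|_{L^{p,q}}$. Dyadic cubes: $Q_{j,m}=\prod_{i=1}^n[2^{-j}m_i,2^{-j}(m_i+1))$, $j\in\mathbb Z$, $m\in\mathbb Z^n$; $\mathcal D$ is the set of all of them. Bourgain-Morrey-Lorentz space: $M_{p,q}^{t,r}(\mathbb R^n)$ is the set of measurable $f$ on $\mathbb R^n$ with $\|f\|_{M_{p,q}^{t,r}(\mathbb R^n)}=\left(\sum_{Q\in\mathcal D}|Q|^{r/t-r/p}\|f\|_{L^{p,q}(Q)}^r\right)^{1/r}<\infty$ (supremum over $Q\in\mathcal D$ of $|Q|^{1/t-1/p}\|f\|_{L^{p,q}(Q)}$ if $r=\infty$). *)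

theory Defs
  imports "HOL-Analysis.Analysis"
begin

text \<open>
  All (quasi-)norms below are defined on extended nonnegative functions \<open>g\<close> and take values in
  \<^typ>\<open>ennreal\<close>; for a complex-valued \<open>f\<close> they are applied to \<open>|f|\<close>.  This lets the same
  functionals be applied to the maximal function, which may take the value \<open>\<infinity>\<close>.
\<close>

text \<open>\<open>x\<^sup>a\<close> on the extended half-line; only exponents \<open>a > 0\<close> are used.\<close>
definition epowr :: "ennreal \<Rightarrow> real \<Rightarrow> ennreal" where
  "epowr x a = (if x = \<infinity> then \<infinity> else ennreal (enn2real x powr a))"

definition cabs :: "('a \<Rightarrow> complex) \<Rightarrow> 'a \<Rightarrow> ennreal" where
  "cabs f x = ennreal (norm (f x))"

definition maximal :: "(real ^ 'n \<Rightarrow> complex) \<Rightarrow> real ^ 'n \<Rightarrow> ennreal" where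
  "maximal f x =
     (SUP B \<in> {B. x \<in> B \<and> (\<exists>c \<rho>. 0 < \<rho> \<and> B = ball c \<rho>)}.
        (\<integral>\<^sup>+ y \<in> B. cabs f y \<partial>lebesgue) / emeasure lebesgue B)"

definition distr_fun :: "(real ^ 'n \<Rightarrow> ennreal) \<Rightarrow> real \<Rightarrow> ennreal" where
  "distr_fun g s = emeasure lebesgue {x. g x > ennreal s}"

text \<open>The infimum of the empty set is \<open>\<infinity>\<close>.\<close>
definition rearrangement :: "(real ^ 'n \<Rightarrow> ennreal) \<Rightarrow> real \<Rightarrow> ennreal" where
  "rearrangement g u = (INF s \<in> {s. 0 < s \<and> distr_fun g s \<le> ennreal u}. ennreal s)"

definition lorentz_norm :: "real \<Rightarrow> ennreal \<Rightarrow> (real ^ 'n \<Rightarrow> ennreal) \<Rightarrow> ennreal" where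
  "lorentz_norm p q g =
     (if q = \<infinity> then (SUP u \<in> {0<..}. ennreal (u powr (1 / p)) * rearrangement g u)
      else epowr
        (\<integral>\<^sup>+ u \<in> {0<..}. epowr (ennreal (u powr (1 / p)) * rearrangement g u) (enn2real q)
                        * ennreal (1 / u) \<partial>lborel)
        (1 / enn2real q))"

definition lorentz_norm_on ::
    "real \<Rightarrow> ennreal \<Rightarrow> (real ^ 'n) set \<Rightarrow> (real ^ 'n \<Rightarrow> ennreal) \<Rightarrow> ennreal" where
  "lorentz_norm_on p q Q g = lorentz_norm p q (\<lambda>x. g x * indicator Q x)"

definition dyadic_cube :: "int \<Rightarrow> int ^ 'n \<Rightarrow> (real ^ 'n) set" where
  "dyadic_cube j m =
     {x. \<forall>i. 2 powi (- j) * of_int (m $ i) \<le> x $ i \<and> x $ i < 2 powi (- j) * (of_int (m $ i) + 1)}"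

definition dyadic_cubes :: "(real ^ 'n) set set" where
  "dyadic_cubes = {Q. \<exists>j m. Q = dyadic_cube j m}"

definition bml_norm ::
    "real \<Rightarrow> ennreal \<Rightarrow> real \<Rightarrow> ennreal \<Rightarrow> (real ^ 'n \<Rightarrow> ennreal) \<Rightarrow> ennreal" where
  "bml_norm p q t r g =
     (if r = \<infinity> then
        (SUP Q \<in> dyadic_cubes.
           ennreal (measure lebesgue Q powr (1 / t - 1 / p)) * lorentz_norm_on p q Q g)
      else epowr
        (\<Sum>\<^sub>\<infinity> Q \<in> dyadic_cubes.
           ennreal (measure lebesgue Q powr (enn2real r / t - enn2real r / p))
           * epowr (lorentz_norm_on p q Q g) (enn2real r))
        (1 / enn2real r))"

definition bml_space ::
    "real \<Rightarrow> ennreal \<Rightarrow> real \<Rightarrow> ennreal \<Rightarrow> (real ^ 'n \<Rightarrow> complex) set" where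
  "bml_space p q t r =
     {f. f \<in> borel_measurable lebesgue \<and> bml_norm p q t r (cabs f) < \<infinity>}"

end

theory Submission
  imports Defs
begin

text \<open>
  Let \<open>Q\<close> be a dyadic cube and \<open>Q\<^sub>k\<close> its \<open>k\<close>-th dyadic ancestor.  A ball meeting \<open>Q\<close> either stays in the
  union of the cubes adjacent to \<open>Q\<close>, or is comparable in size to some \<open>Q\<^sub>k\<close> and stays in the union of
  the cubes adjacent to \<open>Q\<^sub>k\<close>.  The balls of the first kind are handled by the boundedness of the maximal
  operator on \<open>L\<^sup>p\<^sup>,\<^sup>q\<close>, those of the second kind by \<open>\<integral>\<^sub>Q |f| \<le> C |Q|\<^sup>1\<^sup>-\<^sup>1\<^sup>/\<^sup>p \<parallel>f\<parallel>\<close>, the norm being that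
  of \<open>L\<^sup>p\<^sup>,\<^sup>q(Q)\<close>.  This bounds the term of \<open>\<M> f\<close> at \<open>Q\<close> by the supremum over \<open>k\<close> of \<open>2\<close> to the power
  \<open>- k n / t\<close> times the terms of \<open>f\<close> at the cubes adjacent to \<open>Q\<^sub>k\<close>.  Since \<open>2\<^sup>k\<^sup>n\<close> cubes share the same \<open>k\<close>-th
  ancestor, summing the \<open>r\<close>-th powers leaves a geometric series that converges because \<open>t < r\<close>.

  For the Lorentz bound, the weak (1,1) inequality applied to \<open>f\<close> cut at the height \<open>f\<^sup>*(u)\<close> gives
  \<open>(\<M> f)\<^sup>*(u) \<le> C \<Sum>\<^sub>k 2\<^sup>-\<^sup>k f\<^sup>*(2\<^sup>-\<^sup>k\<^sup>-\<^sup>1 u)\<close>, and the \<open>k\<close>-th dilation costs only \<open>2\<^sup>k\<^sup>/\<^sup>p\<close> with \<open>p > 1\<close>.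
\<close>

section \<open>Powers and the Lorentz functional\<close>

lemma epowr_ennreal: "0 \<le> x \<Longrightarrow> epowr (ennreal x) a = ennreal (x powr a)"
  by (simp add: epowr_def)

lemma epowr_top [simp]: "epowr top a = top"
  by (simp add: epowr_def)

lemma epowr_0 [simp]: "epowr 0 a = 0"
  by (simp add: epowr_def)

lemma epowr_1 [simp]: "epowr x 1 = x"
  by (cases x) (auto simp: epowr_ennreal)

lemma epowr_eq_0_iff [simp]: "epowr x a = 0 \<longleftrightarrow> x = 0"
  by (cases x) (auto simp: epowr_ennreal)

lemma epowr_eq_top_iff [simp]: "epowr x a = top \<longleftrightarrow> x = top"
  by (cases x) (auto simp: epowr_ennreal)

lemma epowr_mono: "0 \<le> a \<Longrightarrow> x \<le> y \<Longrightarrow> epowr x a \<le> epowr y a"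
  by (cases x; cases y) (auto simp: epowr_ennreal powr_mono2 top_unique intro!: ennreal_leI)

lemma epowr_mult: "epowr (x * y) a = epowr x a * epowr y a"
proof -
  have fin: "epowr (ennreal x * ennreal y) a = epowr (ennreal x) a * epowr (ennreal y) a"
    if "0 \<le> x" "0 \<le> y" for x y
    using that by (simp add: epowr_ennreal powr_mult flip: ennreal_mult)
  have top: "epowr (top * y) a = epowr top a * epowr y a" for y
    by (cases "y = 0") (auto simp: ennreal_top_mult)
  consider "x = top" | "y = top" | "x \<noteq> top" "y \<noteq> top" by blast
  then show ?thesis
  proof cases
    case 2
    then show ?thesis using top[of x] by (metis mult.commute)
  next
    case 3
    then show ?thesis using fin by (metis ennreal_cases)
  qed (use top in simp)
qed

lemma epowr_epowr: "epowr (epowr x a) b = epowr x (a * b)"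
  by (cases x) (auto simp: epowr_ennreal powr_powr)

text \<open>The powers with exponents \<open>a\<close> and \<open>1 / a\<close> are mutually inverse
  increasing maps. Read from right to left, the equivalence turns a bound on every member of a
  family into a bound on the power of its supremum.\<close>

lemma epowr_le_iff: "0 < a \<Longrightarrow> epowr x a \<le> y \<longleftrightarrow> x \<le> epowr y (1 / a)"
  using epowr_mono[of a x "epowr y (1 / a)"] epowr_mono[of "1 / a" "epowr x a" y]
  by (auto simp: epowr_epowr)

lemma one_le_enn2real: "1 \<le> q \<Longrightarrow> q \<noteq> top \<Longrightarrow> 1 \<le> enn2real q"
  using enn2real_mono[of 1 q] by (simp add: less_top)

lemma epowr_measurable [measurable]: "(\<lambda>x. epowr x a) \<in> borel_measurable borel"
  unfolding epowr_def by measurable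

lemma le_epowr_mult:
  assumes "1 \<le> a" "x \<le> S" "0 < S" "S < top"
  shows "epowr x a \<le> x * epowr S (a - 1)"
proof -
  obtain s where s: "S = ennreal s" "0 < s"
    using assms(3,4) by (cases S) auto
  obtain y where y: "x = ennreal y" "0 \<le> y" "y \<le> s"
    using assms(2) s by (cases x) (auto simp: top_unique)
  have "y powr a = y * y powr (a - 1)" 
    using y by (cases "y = 0") (auto simp: powr_diff)
  also have "\<dots> \<le> y * s powr (a - 1)"
    using y s assms by (intro mult_left_mono powr_mono2) auto
  finally show ?thesis
    using y s by (simp add: epowr_ennreal ennreal_leI flip: ennreal_mult)
qed

text \<open>The embedding of l^1 into l^a: no term exceeds the total \<open>S\<close>, so each power
  \<open>x^a\<close> is at most \<open>x S^(a-1)\<close>, and these bounds add up to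
  \<open>S^a\<close>.\<close>

lemma nn_integral_epowr_le:
  assumes "1 \<le> a"
  shows "(\<integral>\<^sup>+i. epowr (x i) a \<partial>count_space I) \<le> epowr (\<integral>\<^sup>+i. x i \<partial>count_space I) a"
proof -
  define S where "S = (\<integral>\<^sup>+i. x i \<partial>count_space I)"
  have le: "x i \<le> S" if "i \<in> I" for i
    unfolding S_def using that by (rule nn_integral_ge_point)
  consider "S = 0" | "S = top" | "0 < S" "S < top"
    by (metis less_top not_gr_zero)
  then show ?thesis
  proof cases
    case 1
    then have "(\<integral>\<^sup>+i. epowr (x i) a \<partial>count_space I) = (\<integral>\<^sup>+i. 0 \<partial>count_space I)"
      using le by (intro nn_integral_cong) auto
    then show ?thesis by simp
  next
    case 2
    then show ?thesis using S_def by auto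
  next
    case 3
    then obtain s where s: "S = ennreal s" "0 < s" by (cases S) auto
    have "(\<integral>\<^sup>+i. epowr (x i) a \<partial>count_space I) \<le> (\<integral>\<^sup>+i. x i * epowr S (a - 1) \<partial>count_space I)"
      using le 3 assms by (intro nn_integral_mono le_epowr_mult) auto
    also have "\<dots> = S * epowr S (a - 1)"
      unfolding S_def by (rule nn_integral_multc) auto
    also have "\<dots> = epowr S a"
      using s by (simp add: epowr_ennreal powr_diff flip: ennreal_mult)
    finally show ?thesis by (simp add: S_def)
  qed
qed

text \<open>No term exceeds the l^a quasi-norm \<open>Y\<close>, so the sum is at most
  \<open>card V\<close> times \<open>Y\<close>. The argument covers exponents below 1 as
  well.\<close>

lemma epowr_sum_le:
  assumes "finite V" "0 < a"
  shows "epowr (\<Sum>v\<in>V. x v) a \<le> ennreal (card V powr a) * (\<Sum>v\<in>V. epowr (x v) a)"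
proof -
  define Y where "Y = epowr (\<Sum>v\<in>V. epowr (x v) a) (1 / a)"
  have "x v \<le> Y" if "v \<in> V" for v
    unfolding Y_def using that assms by (subst epowr_le_iff[symmetric]) (auto intro: member_le_sum)
  then have "(\<Sum>v\<in>V. x v) \<le> (\<Sum>v\<in>V. Y)" by (intro sum_mono)
  then have "(\<Sum>v\<in>V. x v) \<le> ennreal (card V) * Y" by (simp add: ennreal_of_nat_eq_real_of_nat)
  then have "epowr (\<Sum>v\<in>V. x v) a \<le> epowr (ennreal (card V) * Y) a"
    using assms by (intro epowr_mono) auto
  also have "\<dots> = ennreal (card V powr a) * (\<Sum>v\<in>V. epowr (x v) a)"
    using assms by (simp add: epowr_mult epowr_ennreal Y_def epowr_epowr)
  finally show ?thesis .
qed

section \<open>The Lorentz functional of a function on the half-line\<close>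

text \<open>An arbitrary function takes the place of the rearrangement, because the estimates pass
  through multiples, dilates and suprema of rearrangements.\<close>

definition lorentz_functional :: "real \<Rightarrow> ennreal \<Rightarrow> (real \<Rightarrow> ennreal) \<Rightarrow> ennreal" where
  "lorentz_functional p q \<phi> =
     (if q = \<infinity> then (SUP u \<in> {0<..}. ennreal (u powr (1 / p)) * \<phi> u)
      else epowr
        (\<integral>\<^sup>+ u \<in> {0<..}. epowr (ennreal (u powr (1 / p)) * \<phi> u) (enn2real q)
                        * ennreal (1 / u) \<partial>lborel)
        (1 / enn2real q))"

lemma lorentz_norm_eq: "lorentz_norm p q g = lorentz_functional p q (rearrangement g)"
  by (simp add: lorentz_norm_def lorentz_functional_def)

lemma lorentz_functional_mono:
  assumes "\<And>u. 0 < u \<Longrightarrow> \<phi> u \<le> \<psi> u"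
  shows "lorentz_functional p q \<phi> \<le> lorentz_functional p q \<psi>"
proof (cases "q = \<infinity>")
  case True
  then show ?thesis
    unfolding lorentz_functional_def using assms by (auto intro!: SUP_subset_mono mult_left_mono)
next
  case False
  have "epowr (ennreal (u powr (1 / p)) * \<phi> u) (enn2real q) * ennreal (1 / u) * indicator {0<..} u
     \<le> epowr (ennreal (u powr (1 / p)) * \<psi> u) (enn2real q) * ennreal (1 / u) * indicator {0<..} u" for u
    by (cases "0 < u") (auto intro!: mult_right_mono epowr_mono mult_left_mono assms)
  with False show ?thesis
    by (auto simp: lorentz_functional_def intro!: epowr_mono nn_integral_mono)
qed

lemma lorentz_functional_cmult:
  assumes [measurable]: "\<phi> \<in> borel_measurable borel" and q: "1 \<le> q"
  shows "lorentz_functional p q (\<lambda>u. c * \<phi> u) = c * lorentz_functional p q \<phi>"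
proof (cases "q = \<infinity>")
  case True
  then show ?thesis
    by (simp add: lorentz_functional_def SUP_mult_left_ennreal mult.left_commute)
next
  case False
  define \<kappa> where "\<kappa> = enn2real q"
  have \<kappa>: "0 < \<kappa>" using q False using one_le_enn2real[of q] by (simp add: \<kappa>_def)
  have "(\<integral>\<^sup>+ u \<in> {0<..}. epowr (ennreal (u powr (1 / p)) * (c * \<phi> u)) \<kappa> * ennreal (1 / u) \<partial>lborel)
      = (\<integral>\<^sup>+ u. epowr c \<kappa> * (epowr (ennreal (u powr (1 / p)) * \<phi> u) \<kappa> * ennreal (1 / u) * indicator {0<..} u) \<partial>lborel)"
    by (intro nn_integral_cong) (simp add: epowr_mult mult_ac)
  also have "\<dots> = epowr c \<kappa> * (\<integral>\<^sup>+ u \<in> {0<..}. epowr (ennreal (u powr (1 / p)) * \<phi> u) \<kappa> * ennreal (1 / u) \<partial>lborel)"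
    by (rule nn_integral_cmult) measurable
  finally show ?thesis
    using False \<kappa> by (simp add: lorentz_functional_def epowr_mult epowr_epowr flip: \<kappa>_def)
qed

text \<open>The measure \<open>du / u\<close> is invariant under dilation, so only the weight
  \<open>u^(1/p)\<close> contributes a factor.\<close>

lemma lorentz_functional_dilate:
  assumes [measurable]: "\<phi> \<in> borel_measurable borel" and a: "0 < a" and q: "1 \<le> q"
  shows "lorentz_functional p q (\<lambda>u. \<phi> (a * u)) \<le> ennreal (a powr (- 1 / p)) * lorentz_functional p q \<phi>"
proof -
  have eq: "ennreal (u powr (1 / p)) = ennreal (a powr (- 1 / p)) * ennreal ((a * u) powr (1 / p))"
    if "0 < u" for u
  proof -
    have "a powr (- 1 / p) * (a * u) powr (1 / p) = u powr (1 / p)"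
      using that a by (simp add: powr_mult powr_minus)
    then show ?thesis by (simp flip: ennreal_mult)
  qed
  show ?thesis
  proof (cases "q = \<infinity>")
    case True
    have "ennreal (u powr (1 / p)) * \<phi> (a * u) \<le> ennreal (a powr (- 1 / p)) * lorentz_functional p q \<phi>"
      if "0 < u" for u
    proof -
      have "ennreal ((a * u) powr (1 / p)) * \<phi> (a * u) \<le> lorentz_functional p q \<phi>"
        unfolding lorentz_functional_def using True that a by (auto intro!: SUP_upper2[of "a * u"])
      then show ?thesis
        using that by (subst eq) (auto simp: mult.assoc intro: mult_left_mono)
    qed
    then show ?thesis
      using True by (subst lorentz_functional_def) (auto intro: SUP_least)
  next
    case False
    define \<kappa> where "\<kappa> = enn2real q"
    have \<kappa>: "0 < \<kappa>" using q False using one_le_enn2real[of q] by (simp add: \<kappa>_def)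
    \<comment> \<open>The integrand of the undilated functional. Below, \<open>ennreal a\<close> is
      the Jacobian and \<open>0 + a * u\<close> gives the argument the affine form of the change of
      variables.\<close>
    define F where "F u = epowr (ennreal (u powr (1 / p)) * \<phi> u) \<kappa> * ennreal (1 / u) * indicator {0<..} u" for u
    have [measurable]: "F \<in> borel_measurable borel" unfolding F_def by measurable
    have "(\<integral>\<^sup>+ u \<in> {0<..}. epowr (ennreal (u powr (1 / p)) * \<phi> (a * u)) \<kappa> * ennreal (1 / u) \<partial>lborel)
      = (\<integral>\<^sup>+ u. epowr (ennreal (a powr (- 1 / p))) \<kappa> * (ennreal a * F (0 + a * u)) \<partial>lborel)"
    proof (intro nn_integral_cong)
      fix u :: real
      show "epowr (ennreal (u powr (1 / p)) * \<phi> (a * u)) \<kappa> * ennreal (1 / u) * indicator {0<..} u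
         = epowr (ennreal (a powr (- 1 / p))) \<kappa> * (ennreal a * F (0 + a * u))"
      proof (cases "0 < u")
        case u: True
        have 1: "ennreal (1 / u) = ennreal a * ennreal (1 / (a * u))"
          using u a by (simp flip: ennreal_mult)
        show ?thesis
          unfolding eq[OF u] 1 using u a by (simp add: F_def epowr_mult mult_ac)
      qed (use a in \<open>simp add: F_def zero_less_mult_iff\<close>)
    qed
    also have "\<dots> = epowr (ennreal (a powr (- 1 / p))) \<kappa> * (\<integral>\<^sup>+u. F u \<partial>lborel)"
      using a by (subst nn_integral_real_affine[of F a 0]) (auto simp: nn_integral_cmult)
    finally show ?thesis
      using False \<kappa> by (simp add: lorentz_functional_def epowr_mult epowr_epowr F_def flip: \<kappa>_def)
  qed
qed

text \<open>Since a supremum satisfies \<open>(sup x)\<^sup>q \<le> \<Sum> x\<^sup>q\<close>, replacing sums by suprema avoids Minkowski's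
  inequality throughout.\<close>
lemma lorentz_functional_SUP:
  assumes [measurable]: "\<And>i. i \<in> I \<Longrightarrow> \<phi> i \<in> borel_measurable borel"
    and I: "countable I" and q: "1 \<le> q"
  shows "lorentz_functional p q (\<lambda>u. SUP i\<in>I. \<phi> i u)
     \<le> (\<integral>\<^sup>+i. lorentz_functional p q (\<phi> i) \<partial>count_space I)"
proof (cases "q = \<infinity>")
  case True
  have "ennreal (u powr (1 / p)) * \<phi> i u \<le> (\<integral>\<^sup>+i. lorentz_functional p q (\<phi> i) \<partial>count_space I)"
    if "0 < u" "i \<in> I" for u i
  proof -
    have "ennreal (u powr (1 / p)) * \<phi> i u \<le> lorentz_functional p q (\<phi> i)"
      unfolding lorentz_functional_def using True that by (auto intro!: SUP_upper2[of u])
    also have "\<dots> \<le> (\<integral>\<^sup>+i. lorentz_functional p q (\<phi> i) \<partial>count_space I)"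
      using that(2) by (rule nn_integral_ge_point)
    finally show ?thesis .
  qed
  then show ?thesis
    using True by (subst lorentz_functional_def) (auto intro!: SUP_least simp: SUP_mult_left_ennreal)
next
  case False
  define \<kappa> where "\<kappa> = enn2real q"
  have \<kappa>: "1 \<le> \<kappa>" using q False using one_le_enn2real[of q] by (simp add: \<kappa>_def)
  define F where "F i u = epowr (ennreal (u powr (1 / p)) * \<phi> i u) \<kappa> * ennreal (1 / u) * indicator {0<..} u" for i u
  have [measurable]: "F i \<in> borel_measurable borel" if "i \<in> I" for i unfolding F_def using that by measurable
  have lf: "lorentz_functional p q (\<phi> i) = epowr (\<integral>\<^sup>+u. F i u \<partial>lborel) (1 / \<kappa>)" for i
    using False by (simp add: lorentz_functional_def F_def \<kappa>_def)
  have "epowr (ennreal (u powr (1 / p)) * (SUP i\<in>I. \<phi> i u)) \<kappa> * ennreal (1 / u) * indicator {0<..} u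
      \<le> (\<integral>\<^sup>+i. F i u \<partial>count_space I)" for u
  proof (cases "0 < u")
    case u: True
    let ?S = "\<integral>\<^sup>+i. epowr (ennreal (u powr (1 / p)) * \<phi> i u) \<kappa> \<partial>count_space I"
    have "epowr (ennreal (u powr (1 / p)) * \<phi> i u) \<kappa> \<le> ?S" if "i \<in> I" for i
      using that by (rule nn_integral_ge_point)
    then have "epowr (ennreal (u powr (1 / p)) * (SUP i\<in>I. \<phi> i u)) \<kappa> \<le> ?S"
      using \<kappa> by (simp add: SUP_mult_left_ennreal epowr_le_iff SUP_le_iff)
    then have "epowr (ennreal (u powr (1 / p)) * (SUP i\<in>I. \<phi> i u)) \<kappa> * ennreal (1 / u) \<le> ?S * ennreal (1 / u)"
      by (rule mult_right_mono) simp
    also have "\<dots> = (\<integral>\<^sup>+i. F i u \<partial>count_space I)"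
      using u by (subst nn_integral_multc[symmetric]) (auto simp: F_def)
    finally show ?thesis using u by simp
  qed simp
  then have "(\<integral>\<^sup>+ u \<in> {0<..}. epowr (ennreal (u powr (1 / p)) * (SUP i\<in>I. \<phi> i u)) \<kappa> * ennreal (1 / u) \<partial>lborel)
     \<le> (\<integral>\<^sup>+u. \<integral>\<^sup>+i. F i u \<partial>count_space I \<partial>lborel)"
    by (intro nn_integral_mono)
  also have "\<dots> = (\<integral>\<^sup>+i. \<integral>\<^sup>+u. F i u \<partial>lborel \<partial>count_space I)"
    by (rule nn_integral_count_space_nn_integral[OF I]) measurable
  also have "\<dots> = (\<integral>\<^sup>+i. epowr (lorentz_functional p q (\<phi> i)) \<kappa> \<partial>count_space I)"
    using \<kappa> by (simp add: lf epowr_epowr)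
  \<comment> \<open>The embedding of l^1 into l^\<kappa>, which rests on
    \<open>1 \<le> q\<close>.\<close>
  also have "\<dots> \<le> epowr (\<integral>\<^sup>+i. lorentz_functional p q (\<phi> i) \<partial>count_space I) \<kappa>"
    using \<kappa> by (rule nn_integral_epowr_le)
  finally have "epowr (\<integral>\<^sup>+ u \<in> {0<..}. epowr (ennreal (u powr (1 / p)) * (SUP i\<in>I. \<phi> i u)) \<kappa> * ennreal (1 / u) \<partial>lborel) (1 / \<kappa>)
     \<le> (\<integral>\<^sup>+i. lorentz_functional p q (\<phi> i) \<partial>count_space I)"
    using \<kappa> by (subst epowr_le_iff) auto
  then show ?thesis
    using False by (subst lorentz_functional_def) (simp add: \<kappa>_def)
qed

section \<open>Decreasing rearrangements\<close>

lemma suminf_ennreal_geometric: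
  assumes "0 \<le> x" "x < (1::real)"
  shows "(\<Sum>k. ennreal (x ^ k)) = ennreal (1 / (1 - x))"
  using assms by (intro suminf_ennreal_eq geometric_sums) auto

lemma le_suminf_ennreal: "f k \<le> (\<Sum>k. f k)" for f :: "nat \<Rightarrow> ennreal"
  using sum_le_suminf[OF summableI, of "{k}" f] by simp

lemma rearrangement_antimono: "u \<le> v \<Longrightarrow> rearrangement g v \<le> rearrangement g u"
  unfolding rearrangement_def by (intro INF_superset_mono) (auto intro: order_trans ennreal_leI)

text \<open>The superlevel sets of a decreasing function are intervals.\<close>

lemma rearrangement_measurable [measurable]: "rearrangement g \<in> borel_measurable borel"
proof (rule borel_measurableI_greater)
  fix y
  have "is_interval {u. y < rearrangement g u}"
    unfolding is_interval_1 by (auto intro: less_le_trans rearrangement_antimono)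
  then show "{u \<in> space borel. y < rearrangement g u} \<in> sets borel"
    by (simp add: real_interval_borel_measurable)
qed

declare emeasure_completion [simp del]

lemma superlevel_sets:
  fixes g :: "'a::euclidean_space \<Rightarrow> ennreal"
  assumes "g \<in> borel_measurable lebesgue"
  shows "{x. c < g x} \<in> sets lebesgue"
  using borel_measurable_less[OF borel_measurable_const assms, of c] by simp

text \<open>Only levels \<open>s > 0\<close> enter the definition, so \<open>c\<close> need not be
  admissible itself, for instance when it is 0; \<open>c\<close> plus any positive slack is.\<close>

lemma rearrangement_le:
  assumes [measurable]: "g \<in> borel_measurable lebesgue"
    and le: "emeasure lebesgue {x. c < g x} \<le> ennreal u"
  shows "rearrangement g u \<le> c"
proof (rule ennreal_le_epsilon)
  fix e :: real assume "c < top" "0 < e"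
  then obtain r where r: "c = ennreal r" "0 \<le> r" by (cases c) auto
  have "distr_fun g (r + e) \<le> emeasure lebesgue {x. c < g x}"
    unfolding distr_fun_def r using r \<open>0 < e\<close>
    by (intro emeasure_mono superlevel_sets) (auto intro: le_less_trans[rotated] ennreal_leI)
  then have "rearrangement g u \<le> ennreal (r + e)"
    unfolding rearrangement_def using r \<open>0 < e\<close> le by (intro INF_lower) auto
  then show "rearrangement g u \<le> c + ennreal e"
    using r \<open>0 < e\<close> by simp
qed

text \<open>Continuity of measure from below, along admissible levels decreasing to the infimum.
  Without admissible levels the rearrangement is infinite and the set is empty.\<close>

lemma emeasure_gt_rearrangement:
  assumes [measurable]: "g \<in> borel_measurable lebesgue"
  shows "emeasure lebesgue {x. rearrangement g u < g x} \<le> ennreal u"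
proof (cases "{s. 0 < s \<and> distr_fun g s \<le> ennreal u} = {}")
  case True
  then have "rearrangement g u = top" by (simp add: rearrangement_def)
  then show ?thesis by simp
next
  case False
  then obtain f :: "nat \<Rightarrow> ennreal" where f: "decseq f"
    "range f \<subseteq> ennreal ` {s. 0 < s \<and> distr_fun g s \<le> ennreal u}"
    "rearrangement g u = (INF i. f i)"
    unfolding rearrangement_def
    using ennreal_Inf_countable_INF[of "ennreal ` {s. 0 < s \<and> distr_fun g s \<le> ennreal u}"] by auto
  have "{x. rearrangement g u < g x} = (\<Union>i. {x. f i < g x})"
    by (auto simp: f(3) INF_less_iff)
  also have "emeasure lebesgue \<dots> = (SUP i. emeasure lebesgue {x. f i < g x})"
    using f(1) by (intro SUP_emeasure_incseq[symmetric])
      (auto intro: superlevel_sets simp: incseq_def decseq_def intro: le_less_trans)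
  also have "\<dots> \<le> ennreal u"
  proof (rule SUP_least)
    fix i
    obtain s where "f i = ennreal s" "distr_fun g s \<le> ennreal u" using f(2) by blast
    then show "emeasure lebesgue {x. f i < g x} \<le> ennreal u" by (simp add: distr_fun_def)
  qed
  finally show ?thesis .
qed

lemma rearrangement_mono:
  assumes "\<And>x. g x \<le> h x"
    and [measurable]: "g \<in> borel_measurable lebesgue" "h \<in> borel_measurable lebesgue"
  shows "rearrangement g u \<le> rearrangement h u"
proof (rule rearrangement_le)
  have "emeasure lebesgue {x. rearrangement h u < g x} \<le> emeasure lebesgue {x. rearrangement h u < h x}"
    using assms(1) by (intro emeasure_mono superlevel_sets) (auto intro: less_le_trans)
  also have "\<dots> \<le> ennreal u" by (rule emeasure_gt_rearrangement) fact
  finally show "emeasure lebesgue {x. rearrangement h u < g x} \<le> ennreal u" .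
qed fact

lemma lorentz_norm_mono:
  assumes "\<And>x. g x \<le> h x" "g \<in> borel_measurable lebesgue" "h \<in> borel_measurable lebesgue"
  shows "lorentz_norm p q g \<le> lorentz_norm p q h"
  unfolding lorentz_norm_eq using assms by (intro lorentz_functional_mono rearrangement_mono)

text \<open>Each function exceeds its own rearrangement at \<open>u / card I\<close> on a set of
  measure at most \<open>u / card I\<close>; the union of these sets has measure at most
  \<open>u\<close>.\<close>

lemma rearrangement_SUP:
  assumes I: "finite I" "I \<noteq> {}" and u: "0 < u"
    and [measurable]: "\<And>i. i \<in> I \<Longrightarrow> g i \<in> borel_measurable lebesgue"
  shows "rearrangement (\<lambda>x. SUP i\<in>I. g i x) u \<le> (SUP i\<in>I. rearrangement (g i) (u / card I))"
proof (rule rearrangement_le)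
  let ?c = "SUP i\<in>I. rearrangement (g i) (u / card I)"
  show "(\<lambda>x. SUP i\<in>I. g i x) \<in> borel_measurable lebesgue"
    using I by (intro borel_measurable_SUP) (auto intro: countable_finite)
  have "{x. ?c < (SUP i\<in>I. g i x)} \<subseteq> (\<Union>i\<in>I. {x. rearrangement (g i) (u / card I) < g i x})"
    by (auto simp: less_SUP_iff intro: le_less_trans[OF SUP_upper])
  then have "emeasure lebesgue {x. ?c < (SUP i\<in>I. g i x)}
      \<le> emeasure lebesgue (\<Union>i\<in>I. {x. rearrangement (g i) (u / card I) < g i x})"
    using I by (intro emeasure_mono sets.finite_UN superlevel_sets) auto
  also have "\<dots> \<le> (\<Sum>i\<in>I. emeasure lebesgue {x. rearrangement (g i) (u / card I) < g i x})"
    using I by (intro emeasure_subadditive_finite) (auto intro: superlevel_sets)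
  also have "\<dots> \<le> (\<Sum>i\<in>I. ennreal (u / card I))"
    by (intro sum_mono emeasure_gt_rearrangement) auto
  also have "\<dots> = ennreal u"
    using I u by (simp add: ennreal_of_nat_eq_real_of_nat flip: ennreal_mult)
  finally show "emeasure lebesgue {x. ?c < (SUP i\<in>I. g i x)} \<le> ennreal u" .
qed

text \<open>This plays the role of the triangle inequality. The constant is the cost of dilating the
  rearrangements by \<open>1 / card I\<close>.\<close>

lemma lorentz_norm_SUP:
  assumes I: "finite I" "I \<noteq> {}" and q: "1 \<le> q"
    and [measurable]: "\<And>i. i \<in> I \<Longrightarrow> g i \<in> borel_measurable lebesgue"
  shows "lorentz_norm p q (\<lambda>x. SUP i\<in>I. g i x)
     \<le> ennreal (card I powr (1 / p)) * (\<Sum>i\<in>I. lorentz_norm p q (g i))"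
proof -
  let ?N = "real (card I)"
  have N: "0 < ?N" using I by (simp add: card_gt_0_iff)
  have dil: "lorentz_functional p q (\<lambda>u. rearrangement (g i) (u / ?N))
      \<le> ennreal (?N powr (1 / p)) * lorentz_norm p q (g i)" for i
  proof -
    have "(1 / ?N) powr (- 1 / p) = ?N powr (1 / p)" using N by (simp add: powr_divide powr_minus)
    then show ?thesis
      using lorentz_functional_dilate[of "rearrangement (g i)" "1 / ?N" q p] N q
      by (simp add: lorentz_norm_eq)
  qed
  have "lorentz_norm p q (\<lambda>x. SUP i\<in>I. g i x)
      \<le> lorentz_functional p q (\<lambda>u. SUP i\<in>I. rearrangement (g i) (u / ?N))"
    unfolding lorentz_norm_eq using I by (intro lorentz_functional_mono rearrangement_SUP) auto
  also have "\<dots> \<le> (\<integral>\<^sup>+i. lorentz_functional p q (\<lambda>u. rearrangement (g i) (u / ?N)) \<partial>count_space I)"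
    using I q by (intro lorentz_functional_SUP) (auto intro: countable_finite)
  also have "\<dots> = (\<Sum>i\<in>I. lorentz_functional p q (\<lambda>u. rearrangement (g i) (u / ?N)))"
    using I by (simp add: nn_integral_count_space_finite)
  also have "\<dots> \<le> (\<Sum>i\<in>I. ennreal (?N powr (1 / p)) * lorentz_norm p q (g i))"
    by (intro sum_mono dil)
  finally show ?thesis by (simp add: sum_distrib_left)
qed

section \<open>Weak-type control by the Lorentz norm and integrals over sets of finite
  measure\<close>

text \<open>The embedding into weak L^p. On \<open>{u/2..u}\<close> the weighted function is at
  least its value \<open>X\<close> formed from the weight at the left end and the function at the
  right end, so that interval alone gives the bound.\<close>

lemma antimono_le_lorentz_functional:
  assumes anti: "\<And>u v. u \<le> v \<Longrightarrow> \<phi> v \<le> \<phi> u" and u: "0 < u" and p: "0 < p" and q: "1 \<le> q"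
  shows "\<phi> u \<le> ennreal (2 powr (1 + 1 / p) * u powr (- 1 / p)) * lorentz_functional p q \<phi>"
proof -
  define X where "X = ennreal ((u / 2) powr (1 / p)) * \<phi> u"
  have X: "X \<le> 2 * lorentz_functional p q \<phi>"
  proof (cases "q = \<infinity>")
    case True
    have "X \<le> ennreal (u powr (1 / p)) * \<phi> u"
      unfolding X_def using u p by (intro mult_right_mono ennreal_leI powr_mono2) auto
    also have "\<dots> \<le> lorentz_functional p q \<phi>"
      unfolding lorentz_functional_def using True u by (auto intro!: SUP_upper2[of u])
    also have "\<dots> \<le> 2 * lorentz_functional p q \<phi>"
      using mult_right_mono[of 1 2 "lorentz_functional p q \<phi>"] by simp
    finally show ?thesis .
  next
    case False
    define \<kappa> where "\<kappa> = enn2real q"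
    have \<kappa>: "1 \<le> \<kappa>" using q False one_le_enn2real[of q] by (simp add: \<kappa>_def)
    \<comment> \<open>The interval has length \<open>u / 2\<close> and the density is bounded below
      by \<open>1 / u\<close> on it, whence the factor 1/2.\<close>
    have "epowr X \<kappa> * ennreal (1 / 2) = (\<integral>\<^sup>+v. epowr X \<kappa> * ennreal (1 / u) * indicator {u/2..u} v \<partial>lborel)"
      using u by (subst nn_integral_cmult) (auto simp: mult.assoc simp flip: ennreal_mult)
    also have "\<dots> \<le> (\<integral>\<^sup>+ v \<in> {0<..}. epowr (ennreal (v powr (1 / p)) * \<phi> v) \<kappa> * ennreal (1 / v) \<partial>lborel)"
    proof (rule nn_integral_mono)
      fix v
      show "epowr X \<kappa> * ennreal (1 / u) * indicator {u/2..u} v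
        \<le> epowr (ennreal (v powr (1 / p)) * \<phi> v) \<kappa> * ennreal (1 / v) * indicator {0<..} v"
      proof (cases "v \<in> {u/2..u}")
        case True
        then have v: "0 < v" "u / 2 \<le> v" "v \<le> u" using u by auto
        then have "X \<le> ennreal (v powr (1 / p)) * \<phi> v"
          unfolding X_def using p u by (intro mult_mono ennreal_leI powr_mono2 anti) auto
        then have "epowr X \<kappa> * ennreal (1 / u) \<le> epowr (ennreal (v powr (1 / p)) * \<phi> v) \<kappa> * ennreal (1 / v)"
          using v u \<kappa> by (intro mult_mono epowr_mono ennreal_leI) (auto simp: field_simps)
        then show ?thesis using v by simp
      qed simp
    qed
    finally have "epowr (epowr X \<kappa> * ennreal (1 / 2)) (1 / \<kappa>) \<le> lorentz_functional p q \<phi>"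
      using False \<kappa> by (simp add: lorentz_functional_def epowr_mono flip: \<kappa>_def)
    then have le: "X * ennreal ((1 / 2) powr (1 / \<kappa>)) \<le> lorentz_functional p q \<phi>"
      using \<kappa> by (simp add: epowr_mult epowr_epowr epowr_ennreal del: ennreal_half)
    \<comment> \<open>This makes the constant independent of \<open>q\<close>.\<close>
    have "1 / 2 \<le> (1 / 2 :: real) powr (1 / \<kappa>)"
      using powr_mono'[of "1 / \<kappa>" 1 "1 / 2 :: real"] \<kappa> by simp
    then have "1 \<le> 2 * ennreal ((1 / 2) powr (1 / \<kappa>))"
      using ennreal_leI[of 1 "2 * (1 / 2 :: real) powr (1 / \<kappa>)"] by (simp add: ennreal_mult)
    then have "X \<le> X * (2 * ennreal ((1 / 2) powr (1 / \<kappa>)))"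
      using mult_left_mono[of 1 _ X] by fastforce
    also have "\<dots> \<le> 2 * lorentz_functional p q \<phi>"
      using mult_left_mono[OF le, of 2] by (simp add: mult_ac)
    finally show ?thesis .
  qed
  have "\<phi> u = ennreal ((u / 2) powr (- 1 / p)) * X"
    unfolding X_def using u by (simp add: mult.assoc[symmetric] powr_minus flip: ennreal_mult)
  also have "\<dots> \<le> ennreal ((u / 2) powr (- 1 / p)) * (2 * lorentz_functional p q \<phi>)"
    by (intro mult_left_mono X) simp
  also have "\<dots> = ennreal ((u / 2) powr (- 1 / p) * 2) * lorentz_functional p q \<phi>"
    by (simp add: ennreal_mult mult.assoc)
  also have "(u / 2) powr (- 1 / p) * 2 = 2 powr (1 + 1 / p) * u powr (- 1 / p)"
  proof -
    have "(u / 2) powr (- (1 / p)) = u powr (- (1 / p)) * 2 powr (1 / p)"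
      using u by (simp add: powr_divide powr_minus_divide)
    then show ?thesis by (simp add: powr_add)
  qed
  finally show ?thesis .
qed

lemma rearrangement_le_lorentz_norm:
  assumes "0 < u" "0 < p" "1 \<le> q"
  shows "rearrangement g u \<le> ennreal (2 powr (1 + 1 / p) * u powr (- 1 / p)) * lorentz_norm p q g"
  unfolding lorentz_norm_eq using assms by (intro antimono_le_lorentz_functional rearrangement_antimono)

text \<open>Slice \<open>{g > g\<^sup>*(u)}\<close> by the levels \<open>g\<^sup>*(2\<^sup>-\<^sup>k u)\<close>, whose superlevel sets have measure at most
  \<open>2\<^sup>-\<^sup>k u\<close>.\<close>
lemma nn_integral_gt_rearrangement_le:
  assumes [measurable]: "g \<in> borel_measurable lebesgue" and u: "0 < u"
  shows "(\<integral>\<^sup>+x. g x * indicator {x. rearrangement g u < g x} x \<partial>lebesgue)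
     \<le> (\<Sum>k. ennreal (u / 2 ^ k) * rearrangement g (u / 2 ^ Suc k))"
proof -
  define \<tau> where "\<tau> k = rearrangement g (u / 2 ^ k)" for k :: nat
  \<comment> \<open>The points lying above all levels belong to no slice. They form a null set,
    since its measure is at most \<open>u / 2^k\<close> for every \<open>k\<close>.\<close>
  define N where "N = {x. \<forall>k. \<tau> k < g x}"
  have [measurable]: "N \<in> sets lebesgue"
  proof -
    have "N = (\<Inter>k. {x. \<tau> k < g x})" by (auto simp: N_def)
    then show ?thesis by (auto intro!: superlevel_sets assms)
  qed
  have meas: "emeasure lebesgue {x. \<tau> k < g x} \<le> ennreal (u / 2 ^ k)" for k
    unfolding \<tau>_def by (rule emeasure_gt_rearrangement) fact
  have "emeasure lebesgue N \<le> ennreal (u / 2 ^ k)" for k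
    by (rule order_trans[OF emeasure_mono meas]) (auto simp: N_def intro: superlevel_sets)
  moreover have "(\<lambda>k. ennreal (u / 2 ^ k)) \<longlonglongrightarrow> ennreal 0"
  proof (rule tendsto_ennrealI)
    show "(\<lambda>k. u / 2 ^ k) \<longlonglongrightarrow> 0"
      using LIMSEQ_divide_realpow_zero[of 2 u] by simp
  qed
  ultimately have "emeasure lebesgue N \<le> ennreal 0"
    by (intro LIMSEQ_le_const) auto
  then have "N \<in> null_sets lebesgue" by (simp add: null_sets_def)
  then have "AE x in lebesgue. x \<notin> N" by (rule AE_not_in)
  then have "AE x in lebesgue. g x * indicator {x. rearrangement g u < g x} x
      \<le> (\<Sum>k. \<tau> (Suc k) * indicator {x. \<tau> k < g x} x)"
  proof eventually_elim
    case (elim x)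
    show ?case
    proof (cases "\<tau> 0 < g x")
      case True
      have ex: "\<exists>k. \<not> \<tau> k < g x" using elim by (auto simp: N_def)
      \<comment> \<open>The first level not exceeded by \<open>g x\<close>. The predecessor
        \<open>k\<close> of \<open>m\<close> indexes the slice containing \<open>x\<close>, and on
        that slice \<open>g x\<close> is at most the next level.\<close>
      define m where "m = (LEAST k. \<not> \<tau> k < g x)"
      have m: "\<not> \<tau> m < g x" unfolding m_def by (rule LeastI_ex[OF ex])
      with True obtain k where k: "m = Suc k" by (cases m) auto
      have "\<tau> k < g x" using not_less_Least[of k "\<lambda>k. \<not> \<tau> k < g x"] k by (auto simp: m_def)
      have "g x * indicator {x. rearrangement g u < g x} x \<le> \<tau> (Suc k) * indicator {x. \<tau> k < g x} x"
        using m k \<open>\<tau> k < g x\<close> by (auto simp: not_less split: split_indicator)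
      also have "\<dots> \<le> (\<Sum>k. \<tau> (Suc k) * indicator {x. \<tau> k < g x} x)"
        by (rule le_suminf_ennreal)
      finally show ?thesis .
    qed (simp add: \<tau>_def)
  qed
  then have "(\<integral>\<^sup>+x. g x * indicator {x. rearrangement g u < g x} x \<partial>lebesgue)
      \<le> (\<integral>\<^sup>+x. (\<Sum>k. \<tau> (Suc k) * indicator {x. \<tau> k < g x} x) \<partial>lebesgue)"
    by (rule nn_integral_mono_AE)
  also have "\<dots> = (\<Sum>k. \<integral>\<^sup>+x. \<tau> (Suc k) * indicator {x. \<tau> k < g x} x \<partial>lebesgue)"
    by (rule nn_integral_suminf) measurable
  also have "\<dots> = (\<Sum>k. \<tau> (Suc k) * emeasure lebesgue {x. \<tau> k < g x})"
    by (intro arg_cong[where f=suminf] ext nn_integral_cmult_indicator superlevel_sets) fact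
  also have "\<dots> \<le> (\<Sum>k. \<tau> (Suc k) * ennreal (u / 2 ^ k))"
    by (intro suminf_le mult_left_mono meas) auto
  finally show ?thesis by (simp add: \<tau>_def mult.commute)
qed

text \<open>With \<open>a = 1 / p\<close> this splits the measure of the \<open>k\<close>-th slice
  times the weak-type bound for its height into a geometric factor and a factor free of
  \<open>k\<close>.\<close>

lemma dyadic_powr_identity:
  fixes w a :: real
  assumes w: "0 < w"
  shows "w / 2 ^ k * (2 powr (1 + a) * (w / 2 ^ Suc k) powr (- a))
     = (2 powr (a - 1)) ^ k * (2 powr (1 + 2 * a) * w powr (1 - a))"
proof -
  have 1: "w / 2 ^ k = w * 2 powr (- real k)"
    by (simp add: powr_minus powr_realpow divide_inverse)
  have "w / 2 ^ Suc k = w * 2 powr (- real (Suc k))"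
    by (simp only: powr_minus powr_realpow divide_inverse zero_less_numeral)
  then have 2: "(w / 2 ^ Suc k) powr (- a) = w powr (- a) * 2 powr (real (Suc k) * a)"
    using w by (simp add: powr_mult powr_powr del: of_nat_Suc power_Suc)
  have 3: "(2 powr (a - 1)) ^ k = 2 powr ((a - 1) * k)"
    by (simp add: powr_powr flip: powr_realpow)
  have 4: "w powr (1 - a) = w * w powr (- a)"
    using w by (simp add: powr_diff powr_minus divide_inverse)
  have "2 powr (- real k) * 2 powr (1 + a) * 2 powr (real (Suc k) * a)
      = 2 powr ((a - 1) * k) * 2 powr (1 + 2 * a)"
    by (simp add: algebra_simps flip: powr_add)
  then have "w * w powr (- a) * (2 powr (- real k) * 2 powr (1 + a) * 2 powr (real (Suc k) * a))
     = w * w powr (- a) * (2 powr ((a - 1) * k) * 2 powr (1 + 2 * a))"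
    by (simp only:)
  then show ?thesis unfolding 1 2 3 4 by (simp only: mult_ac)
qed

text \<open>A Hoelder inequality for L^{p,q}. The restriction to \<open>Q\<close> has vanishing
  rearrangement at \<open>w\<close>, so slicing above that level captures the whole integral.
  Bounding the heights by the weak-type estimate leaves a geometric series of ratio
  \<open>2^(1/p - 1)\<close>, which is below 1 because \<open>p > 1\<close>.\<close>

lemma nn_integral_le_lorentz_norm_on:
  assumes [measurable]: "g \<in> borel_measurable lebesgue" "Q \<in> sets lebesgue"
    and Q: "emeasure lebesgue Q = ennreal w" "0 < w" and p: "1 < p" and q: "1 \<le> q"
  shows "(\<integral>\<^sup>+x\<in>Q. g x \<partial>lebesgue)
     \<le> ennreal (2 powr (1 + 2 / p) / (1 - 2 powr (1 / p - 1)) * w powr (1 - 1 / p)) * lorentz_norm_on p q Q g"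
proof -
  define h where "h x = g x * indicator Q x" for x
  have [measurable]: "h \<in> borel_measurable lebesgue" unfolding h_def by measurable
  have "emeasure lebesgue {x. 0 < h x} \<le> emeasure lebesgue Q"
    by (intro emeasure_mono) (auto simp: h_def split: split_indicator_asm)
  then have "rearrangement h w \<le> 0"
    using Q by (intro rearrangement_le) auto
  then have "(\<integral>\<^sup>+x. h x \<partial>lebesgue) = (\<integral>\<^sup>+x. h x * indicator {x. rearrangement h w < h x} x \<partial>lebesgue)"
    by (intro nn_integral_cong) (auto split: split_indicator)
  also have "\<dots> \<le> (\<Sum>k. ennreal (w / 2 ^ k) * rearrangement h (w / 2 ^ Suc k))"
    using Q by (intro nn_integral_gt_rearrangement_le) auto
  also have "\<dots> \<le> (\<Sum>k. ennreal ((2 powr (1 / p - 1)) ^ k) * (ennreal (2 powr (1 + 2 / p) * w powr (1 - 1 / p)) * lorentz_norm p q h))"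
  proof (intro suminf_le)
    fix k
    have "ennreal (w / 2 ^ k) * rearrangement h (w / 2 ^ Suc k)
      \<le> ennreal (w / 2 ^ k) * (ennreal (2 powr (1 + 1 / p) * (w / 2 ^ Suc k) powr (- 1 / p)) * lorentz_norm p q h)"
      using Q p q by (intro mult_left_mono rearrangement_le_lorentz_norm) auto
    also have "\<dots> = ennreal (w / 2 ^ k * (2 powr (1 + 1 / p) * (w / 2 ^ Suc k) powr (- 1 / p))) * lorentz_norm p q h"
      using Q(2) by (simp only: ennreal_mult mult.assoc divide_nonneg_nonneg powr_ge_zero mult_nonneg_nonneg
          zero_le_power zero_le_numeral less_imp_le)
    also have "w / 2 ^ k * (2 powr (1 + 1 / p) * (w / 2 ^ Suc k) powr (- 1 / p))
       = (2 powr (1 / p - 1)) ^ k * (2 powr (1 + 2 / p) * w powr (1 - 1 / p))"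
      using dyadic_powr_identity[OF Q(2), of k "1 / p"] by simp
    finally show "ennreal (w / 2 ^ k) * rearrangement h (w / 2 ^ Suc k)
      \<le> ennreal ((2 powr (1 / p - 1)) ^ k) * (ennreal (2 powr (1 + 2 / p) * w powr (1 - 1 / p)) * lorentz_norm p q h)"
      by (simp add: ennreal_mult mult.assoc)
  qed auto
  also have "\<dots> = ennreal (1 / (1 - 2 powr (1 / p - 1))) * (ennreal (2 powr (1 + 2 / p) * w powr (1 - 1 / p)) * lorentz_norm p q h)"
  proof -
    have "2 powr (1 / p - 1) < (1::real)" using p by (simp add: powr_less_one)
    then show ?thesis
      by (simp only: ennreal_suminf_multc suminf_ennreal_geometric[OF powr_ge_zero])
  qed
  also have "\<dots> = ennreal (2 powr (1 + 2 / p) / (1 - 2 powr (1 / p - 1)) * w powr (1 - 1 / p)) * lorentz_norm_on p q Q g"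
  proof -
    have "2 powr (1 / p - 1) < (1::real)" using p by (simp add: powr_less_one)
    then show ?thesis
      by (simp add: lorentz_norm_on_def h_def[abs_def] mult.assoc[symmetric] flip: ennreal_mult)
  qed
  finally show ?thesis by (simp add: h_def)
qed

section \<open>The maximal operator on Lorentz spaces\<close>

lemma ennreal_mult_assoc_left:
  "0 \<le> a \<Longrightarrow> 0 \<le> b \<Longrightarrow> ennreal a * (ennreal b * x) = ennreal (a * b) * x"
  by (simp add: ennreal_mult mult.assoc)

text \<open>Extended nonnegative arguments let the operator act directly on truncations and
  restrictions of |f|.\<close>

definition ennreal_maximal :: "(real ^ 'n \<Rightarrow> ennreal) \<Rightarrow> real ^ 'n \<Rightarrow> ennreal" where
  "ennreal_maximal g x =
     (SUP B \<in> {B. x \<in> B \<and> (\<exists>c \<rho>. 0 < \<rho> \<and> B = ball c \<rho>)}.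
        (\<integral>\<^sup>+ y \<in> B. g y \<partial>lebesgue) / emeasure lebesgue B)"

lemma maximal_eq: "maximal f = ennreal_maximal (cabs f)"
  by (simp add: fun_eq_iff maximal_def ennreal_maximal_def)

lemma le_ennreal_maximal:
  "0 < \<rho> \<Longrightarrow> x \<in> ball c \<rho> \<Longrightarrow>
    (\<integral>\<^sup>+ y \<in> ball c \<rho>. g y \<partial>lebesgue) / emeasure lebesgue (ball c \<rho>) \<le> ennreal_maximal g x"
  unfolding ennreal_maximal_def by (intro SUP_upper) blast

lemma ennreal_maximal_le:
  assumes "\<And>c \<rho>. 0 < \<rho> \<Longrightarrow> x \<in> ball c \<rho> \<Longrightarrow>
    (\<integral>\<^sup>+ y \<in> ball c \<rho>. g y \<partial>lebesgue) / emeasure lebesgue (ball c \<rho>) \<le> K"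
  shows "ennreal_maximal g x \<le> K"
  unfolding ennreal_maximal_def using assms by (intro SUP_least) blast

lemma less_ennreal_maximal_iff:
  "s < ennreal_maximal g x \<longleftrightarrow> (\<exists>c \<rho>. 0 < \<rho> \<and> x \<in> ball c \<rho> \<and>
    s < (\<integral>\<^sup>+ y \<in> ball c \<rho>. g y \<partial>lebesgue) / emeasure lebesgue (ball c \<rho>))"
  unfolding ennreal_maximal_def by (subst less_SUP_iff) blast

text \<open>The supremum runs over all balls containing the point, not only centred ones, so
  superlevel sets are unions of open balls and hence open.\<close>

lemma ennreal_maximal_measurable [measurable]: "ennreal_maximal g \<in> borel_measurable lebesgue"
proof (rule borel_measurableI_greater)
  fix s
  have "{x. s < ennreal_maximal g x} = (\<Union>(c,\<rho>)\<in>{(c,\<rho>). 0 < \<rho> \<and>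
    s < (\<integral>\<^sup>+ y \<in> ball c \<rho>. g y \<partial>lebesgue) / emeasure lebesgue (ball c \<rho>)}. ball c \<rho>)"
    unfolding less_ennreal_maximal_iff by blast
  then have "open {x. s < ennreal_maximal g x}"
    by auto
  then show "{x \<in> space lebesgue. s < ennreal_maximal g x} \<in> sets lebesgue"
    by simp
qed

section \<open>The weak (1,1) inequality\<close>

lemma ennreal_less_divideD:
  assumes "s < X / ennreal b" "0 < b"
  shows "s * ennreal b \<le> X"
proof -
  have "s * ennreal b \<le> (X / ennreal b) * ennreal b"
    using assms by (intro mult_right_mono) auto
  also have "\<dots> = X"
    using assms by (simp add: ennreal_divide_times ennreal_times_divide[symmetric] flip: mult.assoc)
  finally show ?thesis .
qed

lemma emeasure_lebesgue_ball:
  "0 < \<rho> \<Longrightarrow> emeasure lebesgue (ball (c :: real ^ 'n) \<rho>)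
     = ennreal (unit_ball_vol CARD('n) * \<rho> ^ CARD('n))"
  using emeasure_ball[of \<rho> c] by (simp add: emeasure_completion)

text \<open>Countable subadditivity for an arbitrary countable index set, here a family of pairs of
  centre and radius.\<close>

lemma emeasure_UN_le_nn_integral:
  assumes C: "countable C" and [measurable]: "\<And>i. i \<in> C \<Longrightarrow> A i \<in> sets M"
  shows "emeasure M (\<Union>i\<in>C. A i) \<le> (\<integral>\<^sup>+i. emeasure M (A i) \<partial>count_space C)"
proof -
  have "(\<Union>i\<in>C. A i) \<in> sets M" using C by (intro sets.countable_UN') auto
  then have "emeasure M (\<Union>i\<in>C. A i) = (\<integral>\<^sup>+x. indicator (\<Union>i\<in>C. A i) x \<partial>M)"
    by simp
  also have "\<dots> \<le> (\<integral>\<^sup>+x. \<integral>\<^sup>+i. indicator (A i) x \<partial>count_space C \<partial>M)"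
  proof (rule nn_integral_mono)
    fix x
    show "indicator (\<Union>i\<in>C. A i) x \<le> (\<integral>\<^sup>+i. indicator (A i) x \<partial>count_space C)"
    proof (cases "x \<in> (\<Union>i\<in>C. A i)")
      case True
      then obtain i where i: "i \<in> C" "x \<in> A i" by auto
      have "indicator (A i) x \<le> (\<integral>\<^sup>+i. indicator (A i) x \<partial>count_space C)"
        using i(1) by (rule nn_integral_ge_point)
      moreover have "indicator (\<Union>i\<in>C. A i) x = (indicator (A i) x :: ennreal)"
        using i by (auto simp: indicator_def)
      ultimately show ?thesis by simp
    qed simp
  qed
  also have "\<dots> = (\<integral>\<^sup>+i. \<integral>\<^sup>+x. indicator (A i) x \<partial>M \<partial>count_space C)"
    by (rule nn_integral_count_space_nn_integral[OF C]) measurable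
  also have "\<dots> = (\<integral>\<^sup>+i. emeasure M (A i) \<partial>count_space C)"
    by (intro nn_integral_cong) auto
  finally show ?thesis .
qed

text \<open>By Vitali's covering lemma, the superlevel set is covered by the fivefold dilates of
  countably many disjoint balls whose averages exceed \<open>s\<close>. Dilation multiplies the
  measure by \<open>5^n\<close>, and the integrals of \<open>g\<close> over the disjoint balls add
  up to at most the full integral.\<close>

lemma weak_type_ennreal_maximal:
  fixes g :: "real ^ 'n \<Rightarrow> ennreal"
  assumes [measurable]: "g \<in> borel_measurable lebesgue" and s: "0 < s"
  shows "emeasure lebesgue {x. ennreal s < ennreal_maximal g x}
     \<le> ennreal (5 ^ CARD('n) / s) * (\<integral>\<^sup>+x. g x \<partial>lebesgue)"
proof (cases "(\<integral>\<^sup>+x. g x \<partial>lebesgue) = top")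
  case True
  then show ?thesis using s by (simp add: ennreal_mult_top)
next
  case False
  then obtain I where I: "(\<integral>\<^sup>+x. g x \<partial>lebesgue) = ennreal I" "0 \<le> I"
    by (cases "\<integral>\<^sup>+x. g x \<partial>lebesgue") auto
  let ?n = "CARD('n)" and ?\<omega> = "unit_ball_vol CARD('n)"
  let ?avg = "\<lambda>(c::real^'n) \<rho>. (\<integral>\<^sup>+ y \<in> ball c \<rho>. g y \<partial>lebesgue)"
  have \<omega>: "0 < ?\<omega>" by simp
  define K where "K = {(c, \<rho>). 0 < \<rho> \<and> ennreal s < ?avg c \<rho> / emeasure lebesgue (ball c \<rho>)}"
  have K: "ennreal s * emeasure lebesgue (ball (fst i) (snd i)) \<le> ?avg (fst i) (snd i)"
    and K0: "0 < snd i" if "i \<in> K" for i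
    using that \<omega> by (auto simp: K_def emeasure_lebesgue_ball intro!: ennreal_less_divideD)
  \<comment> \<open>Vitali's lemma needs bounded radii. A large average forces the measure of the
    ball below \<open>I / s\<close>, and the radius is at most its own n-th power once it exceeds
    1.\<close>
  have bd: "snd i \<le> max 1 (I / (s * ?\<omega>))" if "i \<in> K" for i
  proof (cases "snd i \<le> 1")
    case 1: False
    have "ennreal s * emeasure lebesgue (ball (fst i) (snd i)) \<le> ?avg (fst i) (snd i)"
      by (rule K[OF that])
    also have "\<dots> \<le> (\<integral>\<^sup>+x. g x \<partial>lebesgue)"
      by (intro nn_integral_mono) (auto split: split_indicator)
    finally have "ennreal (s * (?\<omega> * snd i ^ ?n)) \<le> ennreal I"
      using s \<omega> K0[OF that] I by (simp add: emeasure_lebesgue_ball flip: ennreal_mult)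
    then have "s * (?\<omega> * snd i ^ ?n) \<le> I" using I by simp
    then have "snd i ^ ?n \<le> I / (s * ?\<omega>)" using s \<omega> by (simp add: field_simps)
    moreover have "snd i ^ 1 \<le> snd i ^ ?n"
      using 1 by (intro power_increasing) (auto simp: Suc_le_eq)
    ultimately show ?thesis by simp
  qed simp
  have cover: "{x. ennreal s < ennreal_maximal g x} \<subseteq> (\<Union>i\<in>K. ball (fst i) (snd i))"
    by (force simp: less_ennreal_maximal_iff K_def)
  obtain C where C: "countable C" "C \<subseteq> K"
     "pairwise (\<lambda>i j. disjnt (ball (fst i) (snd i)) (ball (fst j) (snd j))) C"
     "{x. ennreal s < ennreal_maximal g x} \<subseteq> (\<Union>i\<in>C. ball (fst i) (5 * snd i))"
    by (rule Vitali_covering_lemma_balls[OF cover conjI[OF K0 bd]])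
  have "emeasure lebesgue {x. ennreal s < ennreal_maximal g x}
      \<le> emeasure lebesgue (\<Union>i\<in>C. ball (fst i) (5 * snd i))"
    using C by (intro emeasure_mono sets.countable_UN') auto
  also have "\<dots> \<le> (\<integral>\<^sup>+i. emeasure lebesgue (ball (fst i) (5 * snd i)) \<partial>count_space C)"
    using C by (intro emeasure_UN_le_nn_integral) auto
  also have "\<dots> \<le> (\<integral>\<^sup>+i. ennreal (5 ^ ?n / s) * ?avg (fst i) (snd i) \<partial>count_space C)"
  proof (intro nn_integral_mono)
    fix i assume "i \<in> space (count_space C)"
    then have i: "i \<in> K" using C by auto
    have "emeasure lebesgue (ball (fst i) (5 * snd i))
       = ennreal (5 ^ ?n / s) * (ennreal s * emeasure lebesgue (ball (fst i) (snd i)))"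
      using s \<omega> K0[OF i]
      by (simp add: emeasure_lebesgue_ball power_mult_distrib mult_ac flip: ennreal_mult)
    also have "\<dots> \<le> ennreal (5 ^ ?n / s) * ?avg (fst i) (snd i)"
      by (intro mult_left_mono K[OF i]) simp
    finally show "emeasure lebesgue (ball (fst i) (5 * snd i))
       \<le> ennreal (5 ^ ?n / s) * ?avg (fst i) (snd i)" .
  qed
  also have "\<dots> = ennreal (5 ^ ?n / s) * (\<integral>\<^sup>+i. ?avg (fst i) (snd i) \<partial>count_space C)"
    by (rule nn_integral_cmult) simp
  also have "(\<integral>\<^sup>+i. ?avg (fst i) (snd i) \<partial>count_space C)
     = (\<integral>\<^sup>+x. \<integral>\<^sup>+i. g x * indicator (ball (fst i) (snd i)) x \<partial>count_space C \<partial>lebesgue)"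
    by (rule nn_integral_count_space_nn_integral[OF C(1), symmetric])
      (auto intro!: borel_measurable_times_ennreal borel_measurable_indicator)
  \<comment> \<open>The inner sum is \<open>g x\<close> times the number of selected balls
    containing \<open>x\<close>, which disjointness limits to one.\<close>
  also have "\<dots> \<le> (\<integral>\<^sup>+x. g x \<partial>lebesgue)"
  proof (rule nn_integral_mono)
    fix x
    show "(\<integral>\<^sup>+i. g x * indicator (ball (fst i) (snd i)) x \<partial>count_space C) \<le> g x"
    proof (cases "\<exists>i\<in>C. x \<in> ball (fst i) (snd i)")
      case True
      then obtain i where i: "i \<in> C" "x \<in> ball (fst i) (snd i)" by auto
      define F where "F i = g x * indicator (ball (fst i) (snd i)) x" for i
      have "x \<notin> ball (fst j) (snd j)" if "j \<in> C" "j \<notin> {i}" for j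
        using C(3) i that unfolding pairwise_def disjnt_def by blast
      then have "(\<integral>\<^sup>+i. F i \<partial>count_space C) = (\<Sum>i\<in>{i}. F i)"
        using i by (intro nn_integral_count_space') (auto simp: F_def)
      moreover have "F i = g x" using i by (simp add: F_def)
      ultimately have "(\<integral>\<^sup>+i. F i \<partial>count_space C) = g x" by simp
      then show ?thesis by (simp add: F_def)
    next
      case False
      then have "(\<integral>\<^sup>+i. g x * indicator (ball (fst i) (snd i)) x \<partial>count_space C) = (\<integral>\<^sup>+i. 0 \<partial>count_space C)"
        by (intro nn_integral_cong) auto
      then show ?thesis by simp
    qed
  qed
  finally show ?thesis by (simp add: mult_left_mono)
qed

text \<open>The averages of a constant are that constant. With \<open>h\<close> the part of
  \<open>g\<close> above height \<open>T\<close>, the bounded part only costs an additive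
  \<open>T\<close>.\<close>

lemma ennreal_maximal_add_const:
  assumes le: "\<And>y. g y \<le> h y + T" and [measurable]: "h \<in> borel_measurable lebesgue"
  shows "ennreal_maximal g x \<le> ennreal_maximal h x + T"
proof (rule ennreal_maximal_le)
  fix c :: "real ^ 'a" and \<rho> :: real assume \<rho>: "0 < \<rho>" "x \<in> ball c \<rho>"
  let ?B = "ball c \<rho>"
  obtain b where b: "emeasure lebesgue ?B = ennreal b" "0 < b"
    using \<rho> by (simp add: emeasure_lebesgue_ball)
  have "(\<integral>\<^sup>+ y \<in> ?B. g y \<partial>lebesgue) \<le> (\<integral>\<^sup>+ y. h y * indicator ?B y + T * indicator ?B y \<partial>lebesgue)"
    using le by (intro nn_integral_mono) (auto split: split_indicator)
  also have "\<dots> = (\<integral>\<^sup>+ y \<in> ?B. h y \<partial>lebesgue) + T * ennreal b"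
    using b by (subst nn_integral_add)
      (auto simp: nn_integral_cmult_indicator intro!: borel_measurable_times_ennreal borel_measurable_indicator)
  finally have "(\<integral>\<^sup>+ y \<in> ?B. g y \<partial>lebesgue) / ennreal b
      \<le> ((\<integral>\<^sup>+ y \<in> ?B. h y \<partial>lebesgue) + T * ennreal b) / ennreal b"
    by (rule divide_right_mono_ennreal)
  also have "\<dots> = (\<integral>\<^sup>+ y \<in> ?B. h y \<partial>lebesgue) / ennreal b + T"
    using b by (simp add: add_divide_distrib_ennreal ennreal_mult_divide_eq)
  also have "\<dots> \<le> ennreal_maximal h x + T"
    using le_ennreal_maximal[OF \<rho>, of h] b by (intro add_right_mono) simp
  finally show "(\<integral>\<^sup>+ y \<in> ?B. g y \<partial>lebesgue) / emeasure lebesgue ?B \<le> ennreal_maximal h x + T"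
    using b by simp
qed

text \<open>The part of \<open>g\<close> above height \<open>T\<close> has integral at most
  \<open>u S\<close>, by slicing. The weak (1,1) inequality at a level just above
  \<open>5^n S\<close> thus gives a set of measure at most \<open>u\<close>, outside which the
  maximal function is at most that level plus \<open>T\<close>.\<close>

lemma rearrangement_ennreal_maximal_le:
  fixes g :: "real ^ 'n \<Rightarrow> ennreal"
  assumes [measurable]: "g \<in> borel_measurable lebesgue" and u: "0 < u"
  shows "rearrangement (ennreal_maximal g) u
     \<le> ennreal (1 + 5 ^ CARD('n)) * (\<Sum>k. ennreal (1 / 2 ^ k) * rearrangement g (u / 2 ^ Suc k))"
proof -
  define T where "T = rearrangement g u"
  define S where "S = (\<Sum>k. ennreal (1 / 2 ^ k) * rearrangement g (u / 2 ^ Suc k))"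
  let ?c = "5 ^ CARD('n) :: real"
  \<comment> \<open>Monotonicity of the rearrangement bounds \<open>T\<close> by the term
    \<open>k = 0\<close>, so \<open>T\<close> is absorbed into \<open>S\<close>.\<close>
  have "T \<le> ennreal (1 / 2 ^ 0) * rearrangement g (u / 2 ^ Suc 0)"
    using u by (auto simp: T_def intro: rearrangement_antimono)
  also have "\<dots> \<le> S" unfolding S_def by (rule le_suminf_ennreal)
  finally have TS: "T \<le> S" .
  show ?thesis
  proof (cases "S = top")
    case True
    then show ?thesis unfolding S_def[symmetric] by (simp add: ennreal_mult_top)
  next
    case False
    then obtain \<sigma> where \<sigma>: "S = ennreal \<sigma>" "0 \<le> \<sigma>" by (cases S) auto
    define g1 where "g1 x = g x * indicator {x. T < g x} x" for x
    have [measurable]: "{x. T < g x} \<in> sets lebesgue" by (rule superlevel_sets) fact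
    have [measurable]: "g1 \<in> borel_measurable lebesgue" unfolding g1_def by measurable
    have "(\<integral>\<^sup>+x. g1 x \<partial>lebesgue) \<le> (\<Sum>k. ennreal (u / 2 ^ k) * rearrangement g (u / 2 ^ Suc k))"
      unfolding g1_def T_def using u by (intro nn_integral_gt_rearrangement_le) auto
    also have "\<dots> = (\<Sum>k. ennreal u * (ennreal (1 / 2 ^ k) * rearrangement g (u / 2 ^ Suc k)))"
    proof -
      have "ennreal (u / 2 ^ k) = ennreal u * ennreal (1 / 2 ^ k)" for k
        using u by (simp flip: ennreal_mult)
      then show ?thesis by (simp only: mult.assoc)
    qed
    also have "\<dots> = ennreal u * S" by (simp add: S_def)
    finally have int: "(\<integral>\<^sup>+x. g1 x \<partial>lebesgue) \<le> ennreal u * S" .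
    have "rearrangement (ennreal_maximal g) u \<le> T + ennreal (?c * \<sigma>)"
    proof (rule ennreal_le_epsilon)
      fix e :: real assume e: "0 < e"
      \<comment> \<open>The slack \<open>e\<close> keeps the level positive even when
        \<open>\<sigma> = 0\<close>.\<close>
      let ?s = "?c * \<sigma> + e"
      have s: "0 < ?s" using e \<sigma> by (simp add: add_nonneg_pos)
      have "rearrangement (ennreal_maximal g) u \<le> T + ennreal ?s"
      proof (rule rearrangement_le)
        have "ennreal_maximal g x \<le> ennreal_maximal g1 x + T" for x
          by (rule ennreal_maximal_add_const) (auto simp: g1_def not_less split: split_indicator)
        then have "ennreal ?s < ennreal_maximal g1 x" if "T + ennreal ?s < ennreal_maximal g x" for x
          using less_le_trans[OF that] add_right_mono[of "ennreal_maximal g1 x" "ennreal ?s" T]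
          by (metis add.commute leD leI)
        then have "emeasure lebesgue {x. T + ennreal ?s < ennreal_maximal g x}
           \<le> emeasure lebesgue {x. ennreal ?s < ennreal_maximal g1 x}"
          by (intro emeasure_mono superlevel_sets) auto
        also have "\<dots> \<le> ennreal (?c / ?s) * (\<integral>\<^sup>+x. g1 x \<partial>lebesgue)"
          using s by (intro weak_type_ennreal_maximal) auto
        also have "\<dots> \<le> ennreal (?c / ?s) * (ennreal u * S)"
          by (intro mult_left_mono int) simp
        also have "\<dots> = ennreal (u * (?c * \<sigma> / ?s))"
          using \<sigma> u s by (simp add: mult_ac flip: ennreal_mult)
        also have "\<dots> \<le> ennreal u"
        proof (rule ennreal_leI)
          have "?c * \<sigma> / ?s \<le> 1" using s e by simp
          then show "u * (?c * \<sigma> / ?s) \<le> u" using u by (intro mult_left_le) auto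
        qed
        finally show "emeasure lebesgue {x. T + ennreal ?s < ennreal_maximal g x} \<le> ennreal u" .
      qed simp
      also have "T + ennreal ?s = T + ennreal (?c * \<sigma>) + ennreal e"
        using \<sigma> e by (simp add: add.assoc)
      finally show "rearrangement (ennreal_maximal g) u \<le> T + ennreal (?c * \<sigma>) + ennreal e" .
    qed
    also have "\<dots> \<le> S + ennreal (?c * \<sigma>)" by (intro add_right_mono TS)
    also have "\<dots> = ennreal (1 + ?c) * S"
      using \<sigma> by (simp add: distrib_right flip: ennreal_mult ennreal_plus)
    finally show ?thesis by (simp add: S_def)
  qed
qed

text \<open>The bound on the rearrangement is a weighted sum of dilates. Part of the weight
  \<open>2^(-k)\<close> is spent on replacing the sum by a supremum, to which
  \<open>lorentz_functional_SUP\<close> applies; the rest beats the cost \<open>2^(k/p)\<close> of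
  the \<open>k\<close>-th dilation.\<close>

lemma lorentz_norm_ennreal_maximal_le:
  fixes p :: real and q :: ennreal
  assumes p: "1 < p" and q: "1 \<le> q"
  shows "\<exists>C\<ge>0. \<forall>g :: real ^ 'n \<Rightarrow> ennreal. g \<in> borel_measurable lebesgue \<longrightarrow>
    lorentz_norm p q (ennreal_maximal g) \<le> ennreal C * lorentz_norm p q g"
proof (intro exI conjI allI impI)
  \<comment> \<open>The split \<open>\<theta> \<sigma> = 1/2\<close> is chosen so that
    \<open>\<sigma> 2^(1/p) = \<theta>\<close>: both series are then geometric with the same ratio
    \<open>\<theta>\<close>, and \<open>\<theta> < 1\<close> because \<open>p > 1\<close>.\<close>
  define \<theta> where "\<theta> = 2 powr (- (1 - 1 / p) / 2)"
  define \<sigma> where "\<sigma> = 2 powr (- (1 + 1 / p) / 2)"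
  let ?c = "1 + 5 ^ CARD('n) :: real"
  let ?C = "?c * (1 / (1 - \<theta>)) * (1 / (1 - \<theta>) * 2 powr (1 / p))"
  have \<theta>: "0 \<le> \<theta>" "\<theta> < 1" using p by (auto simp: \<theta>_def powr_less_one)
  have \<sigma>: "0 \<le> \<sigma>" by (simp add: \<sigma>_def)
  have \<theta>\<sigma>: "\<theta> * \<sigma> = 1 / 2"
  proof -
    have "\<theta> * \<sigma> = 2 powr (- 1)" unfolding \<theta>_def \<sigma>_def by (simp add: field_simps flip: powr_add)
    then show ?thesis by (simp add: powr_minus)
  qed
  have \<sigma>2: "\<sigma> * 2 powr (1 / p) = \<theta>"
    unfolding \<theta>_def \<sigma>_def by (simp add: field_simps flip: powr_add)
  show "0 \<le> ?C" using \<theta> by simp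
  fix g :: "real ^ 'n \<Rightarrow> ennreal" assume [measurable]: "g \<in> borel_measurable lebesgue"
  let ?\<phi> = "\<lambda>k u. ennreal (\<sigma> ^ k) * rearrangement g (u / 2 ^ Suc k)"
  have "rearrangement (ennreal_maximal g) u \<le> ennreal (?c * (1 / (1 - \<theta>))) * (SUP k. ?\<phi> k u)"
    if "0 < u" for u
  proof -
    have "(\<Sum>k. ennreal (1 / 2 ^ k) * rearrangement g (u / 2 ^ Suc k))
        = (\<Sum>k. ennreal (\<theta> ^ k) * ?\<phi> k u)"
    proof -
      have "ennreal (1 / 2 ^ k) = ennreal (\<theta> ^ k) * ennreal (\<sigma> ^ k)" for k
      proof -
        have "1 / 2 ^ k = \<theta> ^ k * \<sigma> ^ k"
          by (simp only: power_mult_distrib[symmetric] \<theta>\<sigma> power_one_over)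
        then show ?thesis using \<theta> \<sigma> by (simp add: ennreal_mult)
      qed
      then show ?thesis by (simp only: mult.assoc)
    qed
    also have "\<dots> \<le> (\<Sum>k. ennreal (\<theta> ^ k) * (SUP k. ?\<phi> k u))"
      by (intro suminf_le mult_left_mono SUP_upper) auto
    also have "\<dots> = ennreal (1 / (1 - \<theta>)) * (SUP k. ?\<phi> k u)"
      by (simp only: ennreal_suminf_multc suminf_ennreal_geometric[OF \<theta>])
    finally have "ennreal ?c * (\<Sum>k. ennreal (1 / 2 ^ k) * rearrangement g (u / 2 ^ Suc k))
       \<le> ennreal ?c * (ennreal (1 / (1 - \<theta>)) * (SUP k. ?\<phi> k u))"
      by (rule mult_left_mono) simp
    also have "\<dots> = ennreal (?c * (1 / (1 - \<theta>))) * (SUP k. ?\<phi> k u)"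
      using \<theta> by (intro ennreal_mult_assoc_left) auto
    finally show ?thesis
      using rearrangement_ennreal_maximal_le[of g u] that by auto
  qed
  then have "lorentz_norm p q (ennreal_maximal g)
      \<le> lorentz_functional p q (\<lambda>u. ennreal (?c * (1 / (1 - \<theta>))) * (SUP k. ?\<phi> k u))"
    unfolding lorentz_norm_eq by (rule lorentz_functional_mono)
  also have "\<dots> = ennreal (?c * (1 / (1 - \<theta>))) * lorentz_functional p q (\<lambda>u. SUP k. ?\<phi> k u)"
    using q by (intro lorentz_functional_cmult) measurable
  also have "lorentz_functional p q (\<lambda>u. SUP k. ?\<phi> k u)
      \<le> (\<integral>\<^sup>+k. lorentz_functional p q (?\<phi> k) \<partial>count_space UNIV)"
    using q by (intro lorentz_functional_SUP) auto
  also have "\<dots> = (\<Sum>k. lorentz_functional p q (?\<phi> k))"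
    by (rule nn_integral_count_space_nat)
  also have "\<dots> \<le> (\<Sum>k. ennreal (\<theta> ^ k) * (ennreal (2 powr (1 / p)) * lorentz_norm p q g))"
  proof (intro suminf_le)
    fix k
    have "lorentz_functional p q (?\<phi> k) = ennreal (\<sigma> ^ k) * lorentz_functional p q (\<lambda>u. rearrangement g (1 / 2 ^ Suc k * u))"
      using q by (subst lorentz_functional_cmult) auto
    also have "\<dots> \<le> ennreal (\<sigma> ^ k) * (ennreal ((1 / 2 ^ Suc k) powr (- 1 / p)) * lorentz_norm p q g)"
      unfolding lorentz_norm_eq using q by (intro mult_left_mono lorentz_functional_dilate) auto
    also have "\<dots> = ennreal (\<sigma> ^ k * (1 / 2 ^ Suc k) powr (- 1 / p)) * lorentz_norm p q g"
      using \<sigma> by (simp only: mult.assoc ennreal_mult powr_ge_zero zero_le_power)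
    also have "\<sigma> ^ k * (1 / 2 ^ Suc k) powr (- 1 / p) = \<theta> ^ k * 2 powr (1 / p)"
    proof -
      have "(1 / 2 ^ Suc k) powr (- 1 / p) = (2 ^ Suc k) powr (1 / p)"
        by (simp add: powr_minus powr_divide)
      also have "\<dots> = (2 powr (1 / p)) ^ Suc k"
        by (simp only: powr_powr powr_realpow[symmetric] powr_gt_zero zero_less_numeral mult.commute)
      finally show ?thesis by (simp add: power_mult_distrib flip: \<sigma>2)
    qed
    finally show "lorentz_functional p q (?\<phi> k) \<le> ennreal (\<theta> ^ k) * (ennreal (2 powr (1 / p)) * lorentz_norm p q g)"
      using \<theta> by (simp add: ennreal_mult mult.assoc)
  qed auto
  also have "\<dots> = ennreal (1 / (1 - \<theta>)) * (ennreal (2 powr (1 / p)) * lorentz_norm p q g)"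
    by (simp only: ennreal_suminf_multc suminf_ennreal_geometric[OF \<theta>])
  also have "ennreal (?c * (1 / (1 - \<theta>))) * \<dots> = ennreal ?C * lorentz_norm p q g"
  proof -
    have "ennreal (1 / (1 - \<theta>)) * (ennreal (2 powr (1 / p)) * lorentz_norm p q g)
        = ennreal (1 / (1 - \<theta>) * 2 powr (1 / p)) * lorentz_norm p q g"
      using \<theta> by (intro ennreal_mult_assoc_left) auto
    moreover have "ennreal (?c * (1 / (1 - \<theta>))) * (ennreal (1 / (1 - \<theta>) * 2 powr (1 / p)) * lorentz_norm p q g)
        = ennreal ?C * lorentz_norm p q g"
      using \<theta> by (intro ennreal_mult_assoc_left) auto
    ultimately show ?thesis by (simp only:)
  qed
  finally show "lorentz_norm p q (ennreal_maximal g) \<le> ennreal ?C * lorentz_norm p q g"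
    by (simp add: mult_left_mono)
qed

section \<open>Dyadic cubes\<close>

lemma two_powi_eq_powr: "2 powi j = (2::real) powr of_int j"
  by (simp add: powr_real_of_int')

text \<open>In terms of floors, passing to ancestors and to adjacent cubes becomes integer
  arithmetic on the indices.\<close>

lemma mem_dyadic_cube_iff:
  "x \<in> dyadic_cube j m \<longleftrightarrow> (\<forall>i. \<lfloor>2 powi j * x $ i\<rfloor> = m $ i)"
proof -
  have "2 powi (- j) * of_int a \<le> y \<and> y < 2 powi (- j) * (of_int a + 1) \<longleftrightarrow> \<lfloor>2 powi j * y\<rfloor> = a"
    for y :: real and a
  proof -
    have pos: "0 < (2::real) powi j" by simp
    have "2 powi (- j) * z \<le> y \<longleftrightarrow> z \<le> 2 powi j * y" for z :: real
      using pos by (simp add: power_int_minus field_simps)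
    moreover have "y < 2 powi (- j) * z \<longleftrightarrow> 2 powi j * y < z" for z :: real
      using pos by (simp add: power_int_minus field_simps)
    ultimately show ?thesis by (simp add: floor_eq_iff)
  qed
  then show ?thesis by (simp add: dyadic_cube_def)
qed

lemma dyadic_cube_bounds:
  fixes j :: int and m :: "int ^ 'n"
  defines "l \<equiv> \<chi> i. 2 powi (- j) * of_int (m $ i)" and "h \<equiv> \<chi> i. 2 powi (- j) * (of_int (m $ i) + 1)"
  shows "box l h \<subseteq> dyadic_cube j m" "dyadic_cube j m \<subseteq> cbox l h"
  by (auto simp: l_def h_def dyadic_cube_def mem_box_cart less_imp_le)

lemma dyadic_cube_measurable [measurable]: "dyadic_cube j m \<in> sets lebesgue"
proof -
  have "dyadic_cube j m \<in> sets borel" unfolding dyadic_cube_def by measurable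
  then show ?thesis by simp
qed

lemma emeasure_dyadic_cube:
  fixes m :: "int ^ 'n"
  shows "emeasure lebesgue (dyadic_cube j m) = ennreal (2 powr (- real_of_int j * real CARD('n)))"
proof (rule antisym)
  define l :: "real ^ 'n" where "l = (\<chi> i. 2 powi (- j) * of_int (m $ i))"
  define h :: "real ^ 'n" where "h = (\<chi> i. 2 powi (- j) * (of_int (m $ i) + 1))"
  have diff: "h $ i - l $ i = 2 powi (- j)" for i by (simp add: h_def l_def algebra_simps)
  have "l $ i \<le> h $ i" for i using diff[of i] by (smt (verit) zero_le_power_int zero_le_numeral)
  then have "cbox l h \<noteq> {}" by (simp add: interval_ne_empty_cart)
  then have "measure lebesgue (cbox l h) = (2 powi (- j)) ^ CARD('n)"
    by (simp add: content_cbox_cart diff)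
  also have "\<dots> = 2 powr (- real_of_int j * real CARD('n))"
    by (simp add: two_powi_eq_powr powr_powr flip: powr_realpow)
  finally have c: "emeasure lebesgue (cbox l h) = ennreal (2 powr (- real_of_int j * real CARD('n)))"
    by (simp add: emeasure_eq_measure2 emeasure_completion)
  have "emeasure lebesgue (dyadic_cube j m) \<le> emeasure lebesgue (cbox l h)"
    unfolding l_def h_def by (intro emeasure_mono dyadic_cube_bounds) simp
  then show "emeasure lebesgue (dyadic_cube j m) \<le> ennreal (2 powr (- real_of_int j * real CARD('n)))"
    by (simp add: c)
  have "emeasure lebesgue (cbox l h) = emeasure lebesgue (box l h)"
    by (simp add: emeasure_completion emeasure_lborel_cbox_eq emeasure_lborel_box_eq)
  also have "\<dots> \<le> emeasure lebesgue (dyadic_cube j m)"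
    unfolding l_def h_def by (intro emeasure_mono dyadic_cube_bounds dyadic_cube_measurable)
  finally show "ennreal (2 powr (- real_of_int j * real CARD('n))) \<le> emeasure lebesgue (dyadic_cube j m)"
    by (simp add: c)
qed

lemma measure_dyadic_cube:
  fixes m :: "int ^ 'n"
  shows "measure lebesgue (dyadic_cube j m) = 2 powr (- real_of_int j * real CARD('n))"
  by (simp only: measure_def emeasure_dyadic_cube enn2real_ennreal powr_ge_zero)

text \<open>The measure determines \<open>j\<close>, and the lower corner, which belongs to the
  half-open cube, determines \<open>m\<close>. Hence a sum over the set of cubes is a sum over index
  pairs without repetition.\<close>

lemma dyadic_cube_inject:
  fixes m m' :: "int ^ 'n"
  shows "dyadic_cube j m = dyadic_cube j' m' \<longleftrightarrow> j = j' \<and> m = m'"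
proof
  assume eq: "dyadic_cube j m = dyadic_cube j' m'"
  then have "measure lebesgue (dyadic_cube j m) = measure lebesgue (dyadic_cube j' m')" by simp
  then have j: "j = j'" by (simp add: measure_dyadic_cube powr_inj)
  define x :: "real ^ 'n" where "x = (\<chi> i. 2 powi (- j) * of_int (m $ i))"
  have "2 powi j * x $ i = of_int (m $ i)" for i by (simp add: x_def power_int_minus)
  then have "x \<in> dyadic_cube j m" by (simp add: mem_dyadic_cube_iff)
  then have "x \<in> dyadic_cube j m'" using eq j by simp
  with \<open>x \<in> dyadic_cube j m\<close> have "m = m'" by (simp add: mem_dyadic_cube_iff vec_eq_iff)
  with j show "j = j' \<and> m = m'" by simp
qed simp

section \<open>Sums over dyadic cubes as iterated integrals\<close>

text \<open>As integrals against counting measure, the sums become accessible to Tonelli's theorem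
  and to changes of index.\<close>

lemma infsum_ennreal_eq_nn_integral:
  fixes f :: "'a \<Rightarrow> ennreal"
  assumes "countable A"
  shows "infsum f A = (\<integral>\<^sup>+x. f x \<partial>count_space A)"
proof (cases "finite A")
  case True
  then show ?thesis by (simp add: nn_integral_count_space_finite)
next
  case False
  then have bij: "bij_betw (from_nat_into A) UNIV A"
    using assms by (intro bij_betw_from_nat_into)
  let ?F = "\<lambda>n. f (from_nat_into A n)"
  have "(?F has_sum infsum ?F UNIV) UNIV"
    by (intro has_sum_infsum nonneg_summable_on_complete) simp
  then have "?F sums infsum ?F UNIV" by (rule has_sum_imp_sums)
  then have "infsum ?F UNIV = (\<integral>\<^sup>+n. ?F n \<partial>count_space UNIV)"
    by (simp add: nn_integral_count_space_nat sums_iff)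
  then show ?thesis
    by (simp add: infsum_reindex_bij_betw[OF bij] nn_integral_bij_count_space[OF bij])
qed

lemma nn_integral_dyadic_cubes:
  "(\<integral>\<^sup>+Q. F Q \<partial>count_space (dyadic_cubes :: (real ^ 'n) set set))
     = (\<integral>\<^sup>+j. \<integral>\<^sup>+m. F (dyadic_cube j m) \<partial>count_space UNIV \<partial>count_space UNIV)"
proof -
  have "bij_betw (\<lambda>(j, m). dyadic_cube j m) UNIV (dyadic_cubes :: (real ^ 'n) set set)"
    by (auto simp: bij_betw_def inj_on_def dyadic_cube_inject dyadic_cubes_def image_def)
  then have "(\<integral>\<^sup>+Q. F Q \<partial>count_space (dyadic_cubes :: (real ^ 'n) set set))
      = (\<integral>\<^sup>+z. F ((\<lambda>(j, m). dyadic_cube j m) z) \<partial>count_space UNIV)"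
    by (rule nn_integral_bij_count_space[symmetric])
  then show ?thesis
    by (simp add: nn_integral_fst_count_space[symmetric] case_prod_beta)
qed

lemma countable_dyadic_cubes: "countable (dyadic_cubes :: (real ^ 'n) set set)"
proof -
  have eq: "(dyadic_cubes :: (real ^ 'n) set set) = range (\<lambda>(j, m). dyadic_cube j m)"
    by (auto simp: dyadic_cubes_def image_def)
  show ?thesis unfolding eq by (intro countable_image countableI_type)
qed

section \<open>Ancestors and adjacent cubes\<close>

lemma vec_box:
  fixes A :: "'n::finite \<Rightarrow> 'a set"
  assumes "\<And>i. finite (A i)"
  shows "finite {v :: 'a ^ 'n. \<forall>i. v $ i \<in> A i}"
    and "card {v :: 'a ^ 'n. \<forall>i. v $ i \<in> A i} = (\<Prod>i\<in>UNIV. card (A i))"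
proof -
  have bij: "bij_betw vec_nth {v :: 'a ^ 'n. \<forall>i. v $ i \<in> A i} (Pi\<^sub>E UNIV A)"
    by (rule bij_betwI[of _ _ _ vec_lambda]) (auto simp: vec_eq_iff)
  show "finite {v :: 'a ^ 'n. \<forall>i. v $ i \<in> A i}"
    using bij_betw_finite[OF bij] assms by (auto intro: finite_PiE)
  show "card {v :: 'a ^ 'n. \<forall>i. v $ i \<in> A i} = (\<Prod>i\<in>UNIV. card (A i))"
    using bij_betw_same_card[OF bij] by (simp add: card_PiE)
qed

text \<open>\<open>dyadic_cube j m\<close> is contained in \<open>dyadic_cube (j - int k) (ancestor k m)\<close>.\<close>
definition ancestor :: "nat \<Rightarrow> int ^ 'n \<Rightarrow> int ^ 'n" where
  "ancestor k m = (\<chi> i. m $ i div 2 ^ k)"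

text \<open>The displacements, measured in side lengths, from a cube to the \<open>3^n\<close> cubes
  of its generation whose closures meet its closure, itself included.\<close>

definition unit_offsets :: "(int ^ 'n) set" where
  "unit_offsets = {v. \<forall>i. v $ i \<in> {-1, 0, 1}}"

lemma ancestor_0 [simp]: "ancestor 0 m = m"
  by (simp add: ancestor_def)

lemma finite_unit_offsets [simp]: "finite (unit_offsets :: (int ^ 'n) set)"
  unfolding unit_offsets_def by (rule vec_box) simp

lemma zero_mem_unit_offsets [simp]: "0 \<in> unit_offsets"
  by (simp add: unit_offsets_def)

text \<open>Every index is the \<open>k\<close>-th ancestor of exactly \<open>2^(k n)\<close>
  indices, since integer division by \<open>2^k\<close> has fibres of \<open>2^k\<close> integers in
  each coordinate. Summing over fibres gives the factor.\<close>

lemma nn_integral_ancestor: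
  fixes F :: "int ^ 'n \<Rightarrow> ennreal"
  shows "(\<integral>\<^sup>+m. F (ancestor k m) \<partial>count_space UNIV)
     = ennreal (2 ^ (k * CARD('n))) * (\<integral>\<^sup>+m. F m \<partial>count_space UNIV)"
proof -
  have fibre: "emeasure (count_space UNIV) {m :: int ^ 'n. ancestor k m = m'} = ennreal (2 ^ (k * CARD('n)))" for m'
  proof -
    have div_iff: "a div 2 ^ k = b \<longleftrightarrow> a \<in> {b * 2 ^ k ..< b * 2 ^ k + 2 ^ k}" for a b :: int
    proof
      assume "a div 2 ^ k = b"
      then show "a \<in> {b * 2 ^ k ..< b * 2 ^ k + 2 ^ k}"
        using div_mult_mod_eq[of a "2 ^ k"] pos_mod_bound[of "2 ^ k" a] pos_mod_sign[of "2 ^ k" a]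
        by (simp del: pos_mod_bound pos_mod_sign)
    next
      assume a: "a \<in> {b * 2 ^ k ..< b * 2 ^ k + 2 ^ k}"
      then have "(a - b * 2 ^ k) div 2 ^ k = 0" by (intro div_pos_pos_trivial) auto
      moreover have "a = (a - b * 2 ^ k) + b * 2 ^ k" by simp
      ultimately show "a div 2 ^ k = b"
        by (metis add_0 div_mult_self1 add.commute power_not_zero zero_neq_numeral)
    qed
    have eq: "{m :: int ^ 'n. ancestor k m = m'}
        = {m. \<forall>i. m $ i \<in> {m' $ i * 2 ^ k ..< m' $ i * 2 ^ k + 2 ^ k}}"
      by (simp only: ancestor_def vec_eq_iff vec_lambda_beta div_iff)
    have fin: "finite {m :: int ^ 'n. \<forall>i. m $ i \<in> {m' $ i * 2 ^ k ..< m' $ i * 2 ^ k + 2 ^ k}}"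
      by (rule vec_box) simp
    have "card {m :: int ^ 'n. \<forall>i. m $ i \<in> {m' $ i * 2 ^ k ..< m' $ i * 2 ^ k + 2 ^ k}}
       = (\<Prod>i\<in>(UNIV :: 'n set). card {m' $ i * 2 ^ k ..< m' $ i * 2 ^ k + 2 ^ k})"
      by (rule vec_box) simp
    also have "\<dots> = 2 ^ (k * CARD('n))" by (simp add: nat_power_eq power_mult)
    finally show ?thesis
      unfolding eq by (subst emeasure_count_space_finite) (use fin in \<open>auto simp: ennreal_of_nat_eq_real_of_nat\<close>)
  qed
  have "(\<integral>\<^sup>+m. F (ancestor k m) \<partial>count_space UNIV)
      = (\<integral>\<^sup>+m. \<integral>\<^sup>+m'. F m' * indicator {m. ancestor k m = m'} m \<partial>count_space UNIV \<partial>count_space UNIV)"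
  proof (rule nn_integral_cong)
    fix m :: "int ^ 'n"
    let ?G = "\<lambda>m'. F m' * indicator {m. ancestor k m = m'} m"
    have "(\<integral>\<^sup>+m'. ?G m' \<partial>count_space UNIV) = (\<Sum>m'\<in>{ancestor k m}. ?G m')"
      by (rule nn_integral_count_space') auto
    then show "F (ancestor k m) = (\<integral>\<^sup>+m'. ?G m' \<partial>count_space UNIV)" by simp
  qed
  also have "\<dots> = (\<integral>\<^sup>+m'. \<integral>\<^sup>+m. F m' * indicator {m. ancestor k m = m'} m \<partial>count_space UNIV \<partial>count_space UNIV)"
    by (rule nn_integral_count_space_nn_integral) auto
  also have "\<dots> = (\<integral>\<^sup>+m'. ennreal (2 ^ (k * CARD('n))) * F m' \<partial>count_space UNIV)"
    by (simp add: nn_integral_cmult_indicator fibre mult.commute)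
  also have "\<dots> = ennreal (2 ^ (k * CARD('n))) * (\<integral>\<^sup>+m. F m \<partial>count_space UNIV)"
    by (rule nn_integral_cmult) simp
  finally show ?thesis .
qed

text \<open>Shifts of \<open>j\<close> and \<open>m\<close> are bijections of the index sets, so
  only two multiplicities remain: the descendants of a cube and the offsets.\<close>

lemma nn_integral_ancestor_offsets:
  fixes A :: "int \<Rightarrow> int ^ 'n \<Rightarrow> ennreal"
  assumes "finite V"
  shows "(\<integral>\<^sup>+j. \<integral>\<^sup>+m. (\<Sum>v\<in>V. A (j - int k) (ancestor k m + v)) \<partial>count_space UNIV \<partial>count_space UNIV)
    = ennreal (2 ^ (k * CARD('n)) * real (card V)) * (\<integral>\<^sup>+j. \<integral>\<^sup>+m. A j m \<partial>count_space UNIV \<partial>count_space UNIV)"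
proof -
  have shift: "bij (\<lambda>m. m + v)" for v :: "int ^ 'n"
    by (rule bij_betwI[of _ _ _ "\<lambda>m. m - v"]) auto
  have "(\<integral>\<^sup>+m. (\<Sum>v\<in>V. A j (ancestor k m + v)) \<partial>count_space UNIV)
      = ennreal (2 ^ (k * CARD('n)) * real (card V)) * (\<integral>\<^sup>+m. A j m \<partial>count_space UNIV)" for j
  proof -
    have "(\<integral>\<^sup>+m. (\<Sum>v\<in>V. A j (ancestor k m + v)) \<partial>count_space UNIV)
      = ennreal (2 ^ (k * CARD('n))) * (\<integral>\<^sup>+m. (\<Sum>v\<in>V. A j (m + v)) \<partial>count_space UNIV)"
      by (rule nn_integral_ancestor)
    also have "(\<integral>\<^sup>+m. (\<Sum>v\<in>V. A j (m + v)) \<partial>count_space UNIV)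
        = (\<Sum>v\<in>V. \<integral>\<^sup>+m. A j (m + v) \<partial>count_space UNIV)"
      by (rule nn_integral_sum) simp
    also have "\<dots> = (\<Sum>v\<in>V. \<integral>\<^sup>+m. A j m \<partial>count_space UNIV)"
      by (intro sum.cong refl nn_integral_bij_count_space shift)
    also have "\<dots> = ennreal (card V) * (\<integral>\<^sup>+m. A j m \<partial>count_space UNIV)"
      by (simp add: ennreal_of_nat_eq_real_of_nat)
    finally show ?thesis by (simp add: ennreal_mult mult.assoc)
  qed
  then have "(\<integral>\<^sup>+j. \<integral>\<^sup>+m. (\<Sum>v\<in>V. A (j - int k) (ancestor k m + v)) \<partial>count_space UNIV \<partial>count_space UNIV)
     = (\<integral>\<^sup>+j. ennreal (2 ^ (k * CARD('n)) * real (card V)) * (\<integral>\<^sup>+m. A (j - int k) m \<partial>count_space UNIV) \<partial>count_space UNIV)"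
    by simp
  also have "\<dots> = ennreal (2 ^ (k * CARD('n)) * real (card V)) *
       (\<integral>\<^sup>+j. \<integral>\<^sup>+m. A (j - int k) m \<partial>count_space UNIV \<partial>count_space UNIV)"
    by (rule nn_integral_cmult) simp
  also have "(\<integral>\<^sup>+j. \<integral>\<^sup>+m. A (j - int k) m \<partial>count_space UNIV \<partial>count_space UNIV)
      = (\<integral>\<^sup>+j. \<integral>\<^sup>+m. A j m \<partial>count_space UNIV \<partial>count_space UNIV)"
    by (rule nn_integral_bij_count_space[where g="\<lambda>j. j - int k"])
      (rule bij_betwI[of _ _ _ "\<lambda>j. j + int k"], auto)
  finally show ?thesis .
qed

text \<open>Two points of the ball are less than one side length of the \<open>k\<close>-th ancestor
  apart, so their coordinates, rescaled by that side, have floors differing by at most 1.\<close>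

lemma ball_subset_dyadic_neighbours:
  fixes x c :: "real ^ 'n"
  assumes x: "x \<in> dyadic_cube j m" "x \<in> ball c \<rho>" and \<rho>: "2 * \<rho> \<le> 2 powi (int k - j)"
  shows "ball c \<rho> \<subseteq> (\<Union>v\<in>unit_offsets. dyadic_cube (j - int k) (ancestor k m + v))"
proof
  fix y assume y: "y \<in> ball c \<rho>"
  let ?s = "2 powi (j - int k) :: real"
  have s: "0 < ?s" "?s * 2 powi (int k - j) = 1"
    by (auto simp flip: power_int_add)
  \<comment> \<open>Taking floors commutes with division by \<open>2^k\<close>, so the cube of
    generation \<open>j - k\<close> containing \<open>x\<close> is the one indexed by the
    ancestor.\<close>
  have floor_x: "\<lfloor>?s * x $ i\<rfloor> = ancestor k m $ i" for i
  proof -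
    have "?s * x $ i = 2 powi j * x $ i / of_int (2 ^ k)"
      by (simp add: power_int_diff)
    also have "\<lfloor>\<dots>\<rfloor> = \<lfloor>2 powi j * x $ i\<rfloor> div 2 ^ k"
      by (rule floor_divide_real_eq_div) simp
    finally show ?thesis using x(1) by (simp add: mem_dyadic_cube_iff ancestor_def)
  qed
  define v :: "int ^ 'n" where "v = (\<chi> i. \<lfloor>?s * y $ i\<rfloor> - \<lfloor>?s * x $ i\<rfloor>)"
  have "v $ i \<in> {-1, 0, 1}" for i
  proof -
    have "\<bar>(y - x) $ i\<bar> \<le> norm (y - x)" by (rule component_le_norm_cart)
    also have "\<dots> < 2 * \<rho>"
      using x(2) y dist_triangle_half_r[of c y "2 * \<rho>" x] by (simp add: dist_norm)
    also note \<rho>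
    finally have "?s * \<bar>(y - x) $ i\<bar> < ?s * 2 powi (int k - j)"
      using s(1) by (intro mult_strict_left_mono) auto
    then have "\<bar>?s * y $ i - ?s * x $ i\<bar> < 1"
      using s by (simp add: abs_mult right_diff_distrib[symmetric])
    then have "\<bar>\<lfloor>?s * y $ i\<rfloor> - \<lfloor>?s * x $ i\<rfloor>\<bar> \<le> 1" by linarith
    then show ?thesis unfolding v_def by auto
  qed
  then have "v \<in> unit_offsets" by (simp add: unit_offsets_def)
  moreover have "y \<in> dyadic_cube (j - int k) (ancestor k m + v)"
    by (simp add: mem_dyadic_cube_iff v_def floor_x)
  ultimately show "y \<in> (\<Union>v\<in>unit_offsets. dyadic_cube (j - int k) (ancestor k m + v))" by blast
qed

section \<open>Estimates on a single dyadic cube\<close>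

text \<open>The interval (0,1) is the union of the dyadic dilates of [1/2,1). These contribute a
  geometric series of ratio \<open>2^(-1/p)\<close>, with a bound that does not depend on
  \<open>q\<close>.\<close>

lemma lorentz_functional_unit_interval:
  assumes p: "0 < p" and q: "1 \<le> q"
  shows "lorentz_functional p q (indicator {..<1}) \<le> ennreal (1 / (1 - 2 powr (- 1 / p)))"
proof -
  let ?I = "indicator {1/2..<1} :: real \<Rightarrow> ennreal"
  have base: "lorentz_functional p q ?I \<le> 1"
  proof -
    have le1: "ennreal (u powr (1 / p)) * ?I u \<le> ?I u" if "0 < u" for u
      using that p by (auto simp: powr_le1 split: split_indicator)
    show ?thesis
    proof (cases "q = \<infinity>")
      case True
      have "ennreal (u powr (1 / p)) * ?I u \<le> 1" if "0 < u" for u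
        by (rule order_trans[OF le1[OF that]]) (auto split: split_indicator)
      then show ?thesis using True by (auto simp: lorentz_functional_def intro: SUP_least)
    next
      case False
      define \<kappa> where "\<kappa> = enn2real q"
      have \<kappa>: "1 \<le> \<kappa>" using q False one_le_enn2real[of q] by (simp add: \<kappa>_def)
      have epowr1: "epowr 1 a = 1" for a by (simp add: epowr_def)
      \<comment> \<open>On [1/2,1) the weight is at most 1 and the density \<open>1 / u\<close> at
        most 2, while the length is 1/2.\<close>
      have "(\<integral>\<^sup>+u\<in>{0<..}. epowr (ennreal (u powr (1 / p)) * ?I u) \<kappa> * ennreal (1 / u) \<partial>lborel)
         \<le> (\<integral>\<^sup>+u. ennreal 2 * indicator {1/2..1::real} u \<partial>lborel)"
      proof (rule nn_integral_mono)
        fix u :: real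
        show "epowr (ennreal (u powr (1 / p)) * ?I u) \<kappa> * ennreal (1 / u) * indicator {0<..} u
            \<le> ennreal 2 * indicator {1/2..1} u"
        proof (cases "u \<in> {1/2..<1}")
          case True
          then have "epowr (ennreal (u powr (1 / p)) * ?I u) \<kappa> * ennreal (1 / u) \<le> epowr 1 \<kappa> * ennreal 2"
            using le1[of u] \<kappa> by (intro mult_mono epowr_mono ennreal_leI) (auto simp: field_simps)
          then show ?thesis using True by (simp add: epowr1)
        qed simp
      qed
      also have "\<dots> = ennreal 2 * ennreal (1 / 2)"
        by (subst nn_integral_cmult_indicator) auto
      also have "\<dots> = ennreal (2 * (1 / 2))"
        by (rule ennreal_mult[symmetric]) auto
      also have "\<dots> = 1" by simp
      finally have "epowr (\<integral>\<^sup>+u\<in>{0<..}. epowr (ennreal (u powr (1 / p)) * ?I u) \<kappa> * ennreal (1 / u) \<partial>lborel) (1 / \<kappa>) \<le> epowr 1 (1 / \<kappa>)"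
        using \<kappa> by (intro epowr_mono) auto
      then show ?thesis using False by (simp add: lorentz_functional_def epowr1 flip: \<kappa>_def)
    qed
  qed
  have "indicator {..<1} u \<le> (SUP k. ?I (2 ^ k * u))" if u: "0 < u" for u :: real
  proof (cases "u < 1")
    case True
    obtain k0 where "1 / u < 2 ^ k0" using real_arch_pow[of 2 "1 / u"] by auto
    then have "1 \<le> 2 * (2 ^ k0 * u)" using u by (simp add: field_simps)
    then have ex: "\<exists>k. 1 \<le> 2 * (2 ^ k * u)" by blast
    \<comment> \<open>The least \<open>k\<close> placing \<open>2^k u\<close> at or above 1/2. It
      stays below 1, by minimality for \<open>k > 0\<close> and by \<open>u < 1\<close> for
      \<open>k = 0\<close>.\<close>
    define k where "k = (LEAST k. 1 \<le> 2 * (2 ^ k * u))"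
    have k: "1 \<le> 2 * (2 ^ k * u)" unfolding k_def by (rule LeastI_ex[OF ex])
    have "2 ^ k * u < 1"
    proof (cases k)
      case (Suc l)
      then have "\<not> 1 \<le> 2 * (2 ^ l * u)"
        using not_less_Least[of l "\<lambda>k. 1 \<le> 2 * (2 ^ k * u)"] by (simp add: k_def)
      then show ?thesis using Suc by simp
    qed (use True in simp)
    then have "1 = ?I (2 ^ k * u)" using k by simp
    also have "\<dots> \<le> (SUP k. ?I (2 ^ k * u))" by (rule SUP_upper) simp
    finally show ?thesis using True by simp
  qed simp
  then have "lorentz_functional p q (indicator {..<1}) \<le> lorentz_functional p q (\<lambda>u. SUP k. ?I (2 ^ k * u))"
    by (rule lorentz_functional_mono)
  also have "\<dots> \<le> (\<integral>\<^sup>+k. lorentz_functional p q (\<lambda>u. ?I (2 ^ k * u)) \<partial>count_space UNIV)"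
    using q by (intro lorentz_functional_SUP) measurable
  also have "\<dots> = (\<Sum>k. lorentz_functional p q (\<lambda>u. ?I (2 ^ k * u)))"
    by (rule nn_integral_count_space_nat)
  also have "\<dots> \<le> (\<Sum>k. ennreal ((2 powr (- 1 / p)) ^ k))"
  proof (intro suminf_le)
    fix k
    have "lorentz_functional p q (\<lambda>u. ?I (2 ^ k * u)) \<le> ennreal ((2 ^ k) powr (- 1 / p)) * lorentz_functional p q ?I"
      using q by (intro lorentz_functional_dilate) auto
    also have "\<dots> \<le> ennreal ((2 ^ k) powr (- 1 / p)) * 1"
      by (intro mult_left_mono base) simp
    also have "(2 ^ k) powr (- 1 / p) = (2 powr (- 1 / p)) ^ k"
      by (simp only: powr_powr powr_realpow[symmetric] powr_gt_zero zero_less_numeral mult.commute)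
    finally show "lorentz_functional p q (\<lambda>u. ?I (2 ^ k * u)) \<le> ennreal ((2 powr (- 1 / p)) ^ k)"
      by simp
  qed auto
  also have "\<dots> = ennreal (1 / (1 - 2 powr (- 1 / p)))"
    using p by (intro suminf_ennreal_geometric) (auto simp: powr_less_one)
  finally show ?thesis .
qed

text \<open>The rearrangement is at most \<open>K\<close> before \<open>w\<close> and vanishes from
  \<open>w\<close> on, a dilate of the unit interval. The constant \<open>K\<close> may be
  infinite.\<close>

lemma lorentz_norm_const_on:
  fixes Q :: "(real ^ 'n) set"
  assumes [measurable]: "Q \<in> sets lebesgue"
    and Q: "emeasure lebesgue Q = ennreal w" "0 < w" and p: "0 < p" and q: "1 \<le> q"
  shows "lorentz_norm p q (\<lambda>x. K * indicator Q x)
     \<le> K * ennreal (w powr (1 / p) / (1 - 2 powr (- 1 / p)))"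
proof -
  let ?g = "\<lambda>x. K * indicator Q x"
  have "rearrangement ?g u \<le> K * indicator {..<1} (1 / w * u)" if "0 < u" for u
  proof (cases "u < w")
    case True
    have "{x. K < ?g x} = {}" by (auto split: split_indicator)
    then have "rearrangement ?g u \<le> K" by (intro rearrangement_le) auto
    then show ?thesis using True that Q by simp
  next
    case False
    have "emeasure lebesgue {x. 0 < ?g x} \<le> emeasure lebesgue Q"
      by (intro emeasure_mono) (auto split: split_indicator_asm)
    also have "\<dots> \<le> ennreal u" using False Q by (simp add: ennreal_leI)
    finally have "rearrangement ?g u \<le> 0" by (intro rearrangement_le) auto
    then show ?thesis by simp
  qed
  then have "lorentz_norm p q ?g \<le> lorentz_functional p q (\<lambda>u. K * indicator {..<1} (1 / w * u))"
    unfolding lorentz_norm_eq by (rule lorentz_functional_mono)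
  also have "\<dots> = K * lorentz_functional p q (\<lambda>u. indicator {..<1} (1 / w * u))"
    using q by (intro lorentz_functional_cmult) measurable
  also have "lorentz_functional p q (\<lambda>u. indicator {..<1} (1 / w * u))
      \<le> ennreal ((1 / w) powr (- 1 / p)) * lorentz_functional p q (indicator {..<1})"
    using Q q by (intro lorentz_functional_dilate) auto
  also have "\<dots> \<le> ennreal ((1 / w) powr (- 1 / p)) * ennreal (1 / (1 - 2 powr (- 1 / p)))"
    using p q by (intro mult_left_mono lorentz_functional_unit_interval) auto
  also have "\<dots> = ennreal (w powr (1 / p) / (1 - 2 powr (- 1 / p)))"
  proof -
    have "(1 / w) powr (- 1 / p) = w powr (1 / p)" using Q by (simp add: powr_divide powr_minus)
    moreover have "2 powr (- 1 / p) < (1 :: real)" using p by (simp add: powr_less_one)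
    ultimately show ?thesis by (simp flip: ennreal_mult)
  qed
  finally show ?thesis by (simp add: mult_left_mono)
qed

definition neighbourhood :: "int \<Rightarrow> int ^ 'n \<Rightarrow> (real ^ 'n) set" where
  "neighbourhood j m = (\<Union>v\<in>unit_offsets. dyadic_cube j (m + v))"

lemma neighbourhood_measurable [measurable]: "neighbourhood j m \<in> sets lebesgue"
  unfolding neighbourhood_def by (intro sets.finite_UN) auto

lemma nn_integral_neighbourhood_le:
  assumes "g \<in> borel_measurable lebesgue"
  shows "(\<integral>\<^sup>+y\<in>neighbourhood j m. g y \<partial>lebesgue)
     \<le> (\<Sum>v\<in>unit_offsets. \<integral>\<^sup>+y\<in>dyadic_cube j (m + v). g y \<partial>lebesgue)"
proof -
  have "(\<integral>\<^sup>+y\<in>neighbourhood j m. g y \<partial>lebesgue)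
      \<le> (\<integral>\<^sup>+y. (\<Sum>v\<in>unit_offsets. g y * indicator (dyadic_cube j (m + v)) y) \<partial>lebesgue)"
  proof (rule nn_integral_mono)
    fix y
    show "g y * indicator (neighbourhood j m) y \<le> (\<Sum>v\<in>unit_offsets. g y * indicator (dyadic_cube j (m + v)) y)"
    proof (cases "y \<in> neighbourhood j m")
      case True
      then obtain v where v: "v \<in> unit_offsets" "y \<in> dyadic_cube j (m + v)"
        by (auto simp: neighbourhood_def)
      have "g y * indicator (dyadic_cube j (m + v)) y \<le> (\<Sum>v\<in>unit_offsets. g y * indicator (dyadic_cube j (m + v)) y)"
        using v(1) by (rule member_le_sum) auto
      then show ?thesis using v True by simp
    qed simp
  qed
  also have "\<dots> = (\<Sum>v\<in>unit_offsets. \<integral>\<^sup>+y\<in>dyadic_cube j (m + v). g y \<partial>lebesgue)"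
    using assms by (intro nn_integral_sum borel_measurable_times_ennreal borel_measurable_indicator) auto
  finally show ?thesis .
qed

text \<open>On the neighbourhood \<open>g\<close> is dominated by the maximum of its restrictions to
  the single cubes, so \<open>lorentz_norm_SUP\<close> applies.\<close>

lemma lorentz_norm_on_neighbourhood_le:
  assumes g: "g \<in> borel_measurable lebesgue" and q: "1 \<le> q"
  shows "lorentz_norm_on p q (neighbourhood j m) g
    \<le> ennreal (card (unit_offsets :: (int ^ 'n) set) powr (1 / p))
        * (\<Sum>v\<in>(unit_offsets :: (int ^ 'n) set). lorentz_norm_on p q (dyadic_cube j (m + v)) g)"
proof -
  let ?V = "unit_offsets :: (int ^ 'n) set"
  have meas: "(\<lambda>x. g x * indicator (dyadic_cube j (m + v)) x) \<in> borel_measurable lebesgue" for v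
    using g by (intro borel_measurable_times_ennreal borel_measurable_indicator) auto
  have "lorentz_norm_on p q (neighbourhood j m) g
      \<le> lorentz_norm p q (\<lambda>x. SUP v\<in>?V. g x * indicator (dyadic_cube j (m + v)) x)"
    unfolding lorentz_norm_on_def
  proof (rule lorentz_norm_mono)
    fix y
    show "g y * indicator (neighbourhood j m) y \<le> (SUP v\<in>?V. g y * indicator (dyadic_cube j (m + v)) y)"
    proof (cases "y \<in> neighbourhood j m")
      case True
      then obtain v where v: "v \<in> ?V" "y \<in> dyadic_cube j (m + v)"
        by (auto simp: neighbourhood_def)
      have "g y * indicator (dyadic_cube j (m + v)) y \<le> (SUP v\<in>?V. g y * indicator (dyadic_cube j (m + v)) y)"
        using v(1) by (rule SUP_upper)
      then show ?thesis using v True by simp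
    qed simp
  qed (use g meas in \<open>auto intro!: borel_measurable_times_ennreal borel_measurable_indicator
        borel_measurable_SUP countable_finite\<close>)
  also have "\<dots> \<le> ennreal (card ?V powr (1 / p)) * (\<Sum>v\<in>?V. lorentz_norm p q (\<lambda>x. g x * indicator (dyadic_cube j (m + v)) x))"
    using q meas zero_mem_unit_offsets[where 'a='n] by (intro lorentz_norm_SUP) (auto simp del: zero_mem_unit_offsets)
  finally show ?thesis by (simp add: lorentz_norm_on_def)
qed

text \<open>A ball meeting \<open>Q\<close> is either so small that it stays near \<open>Q\<close>, or comparable in size to some
  dyadic ancestor of \<open>Q\<close> and contained in the neighbourhood of that ancestor.\<close>
lemma ennreal_maximal_le_on_dyadic_cube:
  fixes g :: "real ^ 'n \<Rightarrow> ennreal"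
  assumes g: "g \<in> borel_measurable lebesgue" and x: "x \<in> dyadic_cube j m"
  shows "ennreal_maximal g x \<le>
     max (ennreal_maximal (\<lambda>y. g y * indicator (neighbourhood j m) y) x)
       (SUP k. ennreal (4 ^ CARD('n) / unit_ball_vol CARD('n) * 2 powr (real_of_int (j - int k) * real CARD('n)))
          * (\<integral>\<^sup>+y\<in>neighbourhood (j - int k) (ancestor k m). g y \<partial>lebesgue))"
    (is "_ \<le> max ?L (SUP k. ?K k)")
proof (rule ennreal_maximal_le)
  fix c \<rho> assume \<rho>: "0 < \<rho>" and xB: "x \<in> ball c \<rho>"
  let ?n = "CARD('n)" and ?\<omega> = "unit_ball_vol CARD('n)"
  show "(\<integral>\<^sup>+y\<in>ball c \<rho>. g y \<partial>lebesgue) / emeasure lebesgue (ball c \<rho>) \<le> max ?L (SUP k. ?K k)"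
  proof (cases "2 * \<rho> \<le> 2 powi (- j)")
    case True
    then have "ball c \<rho> \<subseteq> neighbourhood j m"
      using ball_subset_dyadic_neighbours[OF x xB, of 0] by (simp add: neighbourhood_def)
    then have "(\<integral>\<^sup>+y\<in>ball c \<rho>. g y \<partial>lebesgue)
        = (\<integral>\<^sup>+y\<in>ball c \<rho>. (g y * indicator (neighbourhood j m) y) \<partial>lebesgue)"
      by (intro nn_integral_cong) (auto split: split_indicator)
    then show ?thesis
      using le_ennreal_maximal[OF \<rho> xB, of "\<lambda>y. g y * indicator (neighbourhood j m) y"]
      by (simp add: le_max_iff_disj)
  next
    case False
    obtain k0 where "2 * \<rho> / 2 powi (- j) < 2 ^ k0"
      using real_arch_pow[of 2 "2 * \<rho> / 2 powi (- j)"] by auto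
    then have "2 * \<rho> \<le> 2 powi (int k0 - j)"
      by (simp add: power_int_diff power_int_minus field_simps)
    then have ex: "\<exists>k. 2 * \<rho> \<le> 2 powi (int k - j)" by blast
    \<comment> \<open>The smallest ancestor whose side is at least the diameter of the ball.
      Minimality bounds that side by \<open>4 \<rho>\<close>, so ball and ancestor are
      comparable.\<close>
    define k where "k = (LEAST k. 2 * \<rho> \<le> 2 powi (int k - j))"
    have k: "2 * \<rho> \<le> 2 powi (int k - j)" unfolding k_def by (rule LeastI_ex[OF ex])
    with False obtain l where l: "k = Suc l" by (cases k) auto
    have "\<not> 2 * \<rho> \<le> 2 powi (int l - j)"
      using not_less_Least[of l "\<lambda>k. 2 * \<rho> \<le> 2 powi (int k - j)"] l by (simp add: k_def)
    moreover have "2 powi (int k - j) = 2 * (2 :: real) powi (int l - j)"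
      by (simp add: l power_int_diff power_int_add)
    ultimately have lower: "2 powi (int k - j) \<le> 4 * \<rho>" by simp
    define s where "s = (2::real) powi (int k - j)"
    have s: "0 < s" "s \<le> 4 * \<rho>" using lower by (auto simp: s_def)
    have \<omega>: "0 < ?\<omega>" by simp
    \<comment> \<open>The reciprocal measure of the ball is at most a constant times that of the
      ancestor.\<close>
    have inv: "inverse (?\<omega> * \<rho> ^ ?n) \<le> 4 ^ ?n / ?\<omega> * 2 powr (real_of_int (j - int k) * real ?n)"
    proof -
      have "s ^ ?n \<le> 4 ^ ?n * \<rho> ^ ?n"
        using power_mono[OF s(2), of ?n] s(1) by (simp add: power_mult_distrib)
      then have "inverse (\<rho> ^ ?n) \<le> 4 ^ ?n * inverse (s ^ ?n)"
        using s(1) \<rho> by (simp add: field_simps)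
      also have "inverse (s ^ ?n) = 2 powr (real_of_int (j - int k) * real ?n)"
      proof -
        have "inverse s = 2 powr (of_int (j - int k))"
          by (simp add: s_def two_powi_eq_powr flip: powr_minus)
        then have "inverse s ^ ?n = 2 powr (real_of_int (j - int k) * real ?n)"
          by (simp add: powr_powr flip: powr_realpow)
        then show ?thesis by (simp add: power_inverse)
      qed
      finally have "inverse ?\<omega> * inverse (\<rho> ^ ?n) \<le> inverse ?\<omega> * (4 ^ ?n * 2 powr (real_of_int (j - int k) * real ?n))"
        using \<omega> by (intro mult_left_mono) auto
      then show ?thesis by (simp add: divide_inverse mult_ac)
    qed
    have "(\<integral>\<^sup>+y\<in>ball c \<rho>. g y \<partial>lebesgue) / emeasure lebesgue (ball c \<rho>)
        = ennreal (inverse (?\<omega> * \<rho> ^ ?n)) * (\<integral>\<^sup>+y\<in>ball c \<rho>. g y \<partial>lebesgue)"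
      using \<rho> \<omega> by (simp add: emeasure_lebesgue_ball divide_ennreal_def inverse_ennreal mult.commute)
    also have "\<dots> \<le> ?K k"
    proof (intro mult_mono ennreal_leI inv)
      have "ball c \<rho> \<subseteq> neighbourhood (j - int k) (ancestor k m)"
        using ball_subset_dyadic_neighbours[OF x xB k] by (simp add: neighbourhood_def)
      then show "(\<integral>\<^sup>+y\<in>ball c \<rho>. g y \<partial>lebesgue)
          \<le> (\<integral>\<^sup>+y\<in>neighbourhood (j - int k) (ancestor k m). g y \<partial>lebesgue)"
        by (intro nn_integral_mono) (auto split: split_indicator)
    qed auto
    also have "\<dots> \<le> (SUP k. ?K k)" by (rule SUP_upper) simp
    finally show ?thesis by (simp add: le_max_iff_disj)
  qed
qed

text \<open>The local part is controlled by boundedness on L^{p,q}. The other part is a constant on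
  Q, with norm comparable to the constant times \<open>|Q|^(1/p)\<close>; its \<open>k\<close>-th
  term is an average near the ancestor Q_k, bounded by \<open>|Q_k|^(-1/p)\<close> times the norms
  there. The ratio of measures gives the decay \<open>2^(-k n / p)\<close>.\<close>

lemma lorentz_norm_on_ennreal_maximal_le:
  fixes p :: real and q :: ennreal
  assumes p: "1 < p" and q: "1 \<le> q"
  shows "\<exists>C\<ge>0. \<forall>(g :: real ^ 'n \<Rightarrow> ennreal) j m. g \<in> borel_measurable lebesgue \<longrightarrow>
    lorentz_norm_on p q (dyadic_cube j m) (ennreal_maximal g) \<le>
      ennreal C * (SUP k. ennreal (2 powr (- real k * CARD('n) / p)) *
        (\<Sum>v\<in>unit_offsets. lorentz_norm_on p q (dyadic_cube (j - int k) (ancestor k m + v)) g))"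
proof -
  let ?n = "CARD('n)" and ?\<omega> = "unit_ball_vol CARD('n)"
  let ?V = "unit_offsets :: (int ^ 'n) set"
  obtain A where A: "0 \<le> A" "\<And>g :: real ^ 'n \<Rightarrow> ennreal. g \<in> borel_measurable lebesgue \<Longrightarrow>
    lorentz_norm p q (ennreal_maximal g) \<le> ennreal A * lorentz_norm p q g"
    using lorentz_norm_ennreal_maximal_le[OF p q] by blast
  define H where "H = 2 powr (1 + 2 / p) / (1 - 2 powr (1 / p - 1))"
  have "2 powr (1 / p - 1) < (1 :: real)" using p by (simp add: powr_less_one)
  then have H: "0 \<le> H" by (simp add: H_def)
  define D where "D = 1 / (1 - 2 powr (- 1 / p))"
  have "2 powr (- 1 / p) < (1 :: real)" using p by (simp add: powr_less_one)
  then have D: "0 \<le> D" by (simp add: D_def)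
  define E where "E = 4 ^ ?n / ?\<omega>"
  have E: "0 \<le> E" by (simp add: E_def)
  define C where "C = 2 powr (1 / p) * (A * card ?V powr (1 / p) + E * H * D)"
  show ?thesis
  proof (intro exI[of _ C] conjI allI impI)
    show "0 \<le> C" using A H D E by (simp add: C_def)
    fix g :: "real ^ 'n \<Rightarrow> ennreal" and j and m :: "int ^ 'n"
    assume g [measurable]: "g \<in> borel_measurable lebesgue"
    define a where "a j m = lorentz_norm_on p q (dyadic_cube j m) g" for j and m :: "int ^ 'n"
    let ?Q = "dyadic_cube j m"
    let ?S = "SUP k. ennreal (2 powr (- real k * ?n / p)) * (\<Sum>v\<in>?V. a (j - int k) (ancestor k m + v))"
    let ?g0 = "\<lambda>y. g y * indicator (neighbourhood j m) y"
    let ?K = "SUP k. ennreal (E * 2 powr (real_of_int (j - int k) * real ?n))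
          * (\<integral>\<^sup>+y\<in>neighbourhood (j - int k) (ancestor k m). g y \<partial>lebesgue)"
    \<comment> \<open>The maximum of the two parts is indexed by \<open>bool\<close> so that
      \<open>lorentz_norm_SUP\<close> applies with factor \<open>2^(1/p)\<close>.\<close>
    let ?h = "\<lambda>b x. if b then ennreal_maximal ?g0 x else ?K * indicator ?Q x"
    have "lorentz_norm_on p q ?Q (ennreal_maximal g) \<le> lorentz_norm p q (\<lambda>x. SUP b\<in>UNIV. ?h b x)"
      unfolding lorentz_norm_on_def
    proof (rule lorentz_norm_mono)
      fix x
      show "ennreal_maximal g x * indicator ?Q x \<le> (SUP b\<in>UNIV. ?h b x)"
      proof (cases "x \<in> ?Q")
        case True
        then show ?thesis
          using ennreal_maximal_le_on_dyadic_cube[OF g True]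
          by (simp add: UNIV_bool sup_max max.commute E_def)
      qed simp
    qed (auto simp: UNIV_bool)
    also have "\<dots> \<le> ennreal (card (UNIV :: bool set) powr (1 / p)) * (\<Sum>b\<in>UNIV. lorentz_norm p q (?h b))"
      using q by (intro lorentz_norm_SUP) auto
    also have "\<dots> = ennreal (2 powr (1 / p)) *
        (lorentz_norm p q (ennreal_maximal ?g0) + lorentz_norm p q (\<lambda>x. ?K * indicator ?Q x))"
      by (simp add: UNIV_bool add.commute)
    also have "lorentz_norm p q (ennreal_maximal ?g0) \<le> ennreal (A * card ?V powr (1 / p)) * ?S"
    proof -
      have "lorentz_norm p q (ennreal_maximal ?g0) \<le> ennreal A * lorentz_norm_on p q (neighbourhood j m) g"
        unfolding lorentz_norm_on_def by (rule A) measurable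
      also have "\<dots> \<le> ennreal A * (ennreal (card ?V powr (1 / p)) * (\<Sum>v\<in>?V. a j (m + v)))"
        unfolding a_def using g q by (intro mult_left_mono lorentz_norm_on_neighbourhood_le) auto
      \<comment> \<open>The local part is accounted for by the term \<open>k = 0\<close>.\<close>
      also have "(\<Sum>v\<in>?V. a j (m + v)) \<le> ?S"
        by (rule SUP_upper2[of 0]) auto
      finally show ?thesis using A by (simp add: ennreal_mult mult.assoc mult_left_mono)
    qed
    also have "lorentz_norm p q (\<lambda>x. ?K * indicator ?Q x) \<le> ennreal (E * H * D) * ?S"
    proof -
      let ?w = "2 powr (- real_of_int j * real ?n) :: real"
      have K: "?K * ennreal (?w powr (1 / p)) \<le> ennreal (E * H) * ?S"
      proof -
        have "ennreal (E * 2 powr (real_of_int (j - int k) * real ?n))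
            * (\<integral>\<^sup>+y\<in>neighbourhood (j - int k) (ancestor k m). g y \<partial>lebesgue) * ennreal (?w powr (1 / p))
          \<le> ennreal (E * H) * ?S" for k
        proof -
          let ?i = "j - int k" and ?m = "ancestor k m"
          let ?x = "2 powr (- real_of_int ?i * real ?n) :: real"
          have "(\<integral>\<^sup>+y\<in>neighbourhood ?i ?m. g y \<partial>lebesgue)
              \<le> (\<Sum>v\<in>?V. \<integral>\<^sup>+y\<in>dyadic_cube ?i (?m + v). g y \<partial>lebesgue)"
            by (rule nn_integral_neighbourhood_le[OF g])
          also have "\<dots> \<le> (\<Sum>v\<in>?V. ennreal (H * ?x powr (1 - 1 / p)) * a ?i (?m + v))"
            unfolding H_def a_def using p q
            by (intro sum_mono nn_integral_le_lorentz_norm_on emeasure_dyadic_cube g dyadic_cube_measurable) auto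
          also have "\<dots> = ennreal (H * ?x powr (1 - 1 / p)) * (\<Sum>v\<in>?V. a ?i (?m + v))"
            by (simp add: sum_distrib_left)
          finally have "ennreal (E * 2 powr (real_of_int ?i * real ?n))
              * (\<integral>\<^sup>+y\<in>neighbourhood ?i ?m. g y \<partial>lebesgue) * ennreal (?w powr (1 / p))
            \<le> ennreal (E * 2 powr (real_of_int ?i * real ?n))
              * (ennreal (H * ?x powr (1 - 1 / p)) * (\<Sum>v\<in>?V. a ?i (?m + v))) * ennreal (?w powr (1 / p))"
            by (intro mult_right_mono mult_left_mono) auto
          also have "\<dots> = ennreal (E * 2 powr (real_of_int ?i * real ?n) * (H * ?x powr (1 - 1 / p)) * ?w powr (1 / p)) * (\<Sum>v\<in>?V. a ?i (?m + v))"
            using E H by (simp only: ennreal_mult mult_nonneg_nonneg powr_ge_zero mult_ac)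
          \<comment> \<open>Here \<open>?x\<close> and \<open>?w\<close> are the measures of Q_k and
            Q, so the powers combine to \<open>(?w / ?x)^(1/p)\<close>.\<close>
          also have "E * 2 powr (real_of_int ?i * real ?n) * (H * ?x powr (1 - 1 / p)) * ?w powr (1 / p)
              = E * H * 2 powr (- real k * ?n / p)"
          proof -
            have "2 powr (real_of_int ?i * real ?n) * ?x powr (1 - 1 / p) * ?w powr (1 / p) = 2 powr (- real k * ?n / p)"
              unfolding powr_powr powr_add[symmetric]
              by (rule arg_cong[where f="\<lambda>z. 2 powr z"]) (simp add: field_simps)
            moreover have "E * x * (H * y) * z = E * H * (x * y * z)" for x y z
              by (simp only: mult_ac)
            ultimately show ?thesis by (simp only:)
          qed
          also have "ennreal (E * H * 2 powr (- real k * ?n / p)) * (\<Sum>v\<in>?V. a ?i (?m + v))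
             = ennreal (E * H) * (ennreal (2 powr (- real k * ?n / p)) * (\<Sum>v\<in>?V. a ?i (?m + v)))"
            using E H by (intro ennreal_mult_assoc_left[symmetric]) auto
          also have "\<dots> \<le> ennreal (E * H) * ?S"
            by (intro mult_left_mono SUP_upper) auto
          finally show ?thesis .
        qed
        then show ?thesis by (simp add: SUP_mult_right_ennreal SUP_le_iff)
      qed
      have "lorentz_norm p q (\<lambda>x. ?K * indicator ?Q x) \<le> ?K * ennreal (?w powr (1 / p) / (1 - 2 powr (- 1 / p)))"
        using p q by (intro lorentz_norm_const_on emeasure_dyadic_cube dyadic_cube_measurable) auto
      also have "\<dots> = ennreal D * (?K * ennreal (?w powr (1 / p)))"
      proof -
        have "ennreal (?w powr (1 / p) / (1 - 2 powr (- 1 / p))) = ennreal D * ennreal (?w powr (1 / p))"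
          using D by (simp add: D_def flip: ennreal_mult)
        then show ?thesis by (simp only: mult_ac)
      qed
      also have "\<dots> \<le> ennreal D * (ennreal (E * H) * ?S)"
        by (intro mult_left_mono K) simp
      also have "\<dots> = ennreal (E * H * D) * ?S"
        using D E H by (subst ennreal_mult_assoc_left) (auto simp: mult_ac)
      finally show ?thesis .
    qed
    finally have "lorentz_norm_on p q ?Q (ennreal_maximal g)
      \<le> ennreal (2 powr (1 / p)) * (ennreal (A * card ?V powr (1 / p)) * ?S + ennreal (E * H * D) * ?S)"
      by (simp add: add_mono mult_left_mono)
    also have "\<dots> = ennreal C * ?S"
      unfolding C_def using A D E H
      by (simp only: distrib_right[symmetric] ennreal_plus[symmetric] ennreal_mult_assoc_left
          mult_nonneg_nonneg powr_ge_zero add_nonneg_nonneg)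
    finally show "lorentz_norm_on p q ?Q (ennreal_maximal g) \<le> ennreal C * (SUP k. ennreal (2 powr (- real k * ?n / p)) *
        (\<Sum>v\<in>?V. lorentz_norm_on p q (dyadic_cube (j - int k) (ancestor k m + v)) g))"
      by (simp add: a_def)
  qed
qed

section \<open>Summation over dyadic cubes\<close>

lemma bml_norm_top_eq:
  "bml_norm p q t \<infinity> (g :: real ^ 'n \<Rightarrow> ennreal) =
     (SUP j. SUP m. ennreal ((2 powr (- real_of_int j * real CARD('n))) powr (1 / t - 1 / p)) *
        lorentz_norm_on p q (dyadic_cube j m) g)"
proof -
  have "bml_norm p q t \<infinity> g = (SUP Q \<in> dyadic_cubes.
      ennreal (measure lebesgue Q powr (1 / t - 1 / p)) * lorentz_norm_on p q Q g)"
    by (simp add: bml_norm_def)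
  also have "\<dots> = (SUP j. SUP m. ennreal (measure lebesgue (dyadic_cube j m) powr (1 / t - 1 / p))
        * lorentz_norm_on p q (dyadic_cube j m) g)" (is "_ = (SUP j. SUP m. ?F j m)")
  proof (rule antisym)
    show "(SUP Q \<in> dyadic_cubes. ennreal (measure lebesgue Q powr (1 / t - 1 / p)) * lorentz_norm_on p q Q g)
        \<le> (SUP j. SUP m. ?F j m)"
    proof (rule SUP_least)
      fix Q :: "(real ^ 'n) set" assume "Q \<in> dyadic_cubes"
      then obtain j m where Q: "Q = dyadic_cube j m" by (auto simp: dyadic_cubes_def)
      show "ennreal (measure lebesgue Q powr (1 / t - 1 / p)) * lorentz_norm_on p q Q g \<le> (SUP j. SUP m. ?F j m)"
        unfolding Q by (intro SUP_upper2[of j] SUP_upper2[of m]) auto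
    qed
  qed (auto intro!: SUP_least SUP_upper simp: dyadic_cubes_def)
  finally show ?thesis by (simp only: measure_dyadic_cube)
qed

lemma bml_norm_finite_eq:
  fixes g :: "real ^ 'n \<Rightarrow> ennreal"
  assumes "0 \<le> \<rho>"
  shows "bml_norm p q t (ennreal \<rho>) g =
     epowr (\<integral>\<^sup>+j. \<integral>\<^sup>+m. ennreal ((2 powr (- real_of_int j * real CARD('n))) powr (\<rho> / t - \<rho> / p)) *
        epowr (lorentz_norm_on p q (dyadic_cube j m) g) \<rho> \<partial>count_space UNIV \<partial>count_space UNIV) (1 / \<rho>)"
  using assms
  by (simp only: bml_norm_def infsum_ennreal_eq_nn_integral[OF countable_dyadic_cubes]
      nn_integral_dyadic_cubes measure_dyadic_cube enn2real_ennreal infinity_ennreal_def ennreal_neq_top if_False)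

text \<open>Since Q_k has \<open>2^(k n)\<close> times the measure of Q, moving the weight from Q to
  Q_k trades the decay in \<open>1 / p\<close> for decay in \<open>1 / t\<close>.\<close>

lemma weight_shift:
  fixes n p t \<rho> :: real
  shows "(2 powr (- of_int j * n)) powr (\<rho> / t - \<rho> / p) * 2 powr (- real k * n * \<rho> / p)
    = (2 powr (- of_int (j - int k) * n)) powr (\<rho> / t - \<rho> / p) * 2 powr (- real k * n * \<rho> / t)"
  unfolding powr_powr powr_add[symmetric]
  by (rule arg_cong[where f="\<lambda>z. 2 powr z"]) (simp add: field_simps)

text \<open>After the weight is moved to the ancestor, the remaining factor
  \<open>2^(-k n / t)\<close> is at most 1. Every term of the supremum over \<open>k\<close> is thus
  bounded by the norm times the number of offsets.\<close>

lemma bml_norm_top_ennreal_maximal_le: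
  fixes p t :: real and q :: ennreal
  assumes p: "1 < p" and t: "0 < t" and q: "1 \<le> q"
  shows "\<exists>C\<ge>0. \<forall>g :: real ^ 'n \<Rightarrow> ennreal. g \<in> borel_measurable lebesgue \<longrightarrow>
    bml_norm p q t \<infinity> (ennreal_maximal g) \<le> ennreal C * bml_norm p q t \<infinity> g"
proof -
  let ?n = "CARD('n)"
  let ?V = "unit_offsets :: (int ^ 'n) set"
  let ?W = "\<lambda>j. (2 powr (- real_of_int j * real ?n)) powr (1 / t - 1 / p) :: real"
  obtain C where C: "0 \<le> C" and le: "\<And>(g :: real ^ 'n \<Rightarrow> ennreal) j m. g \<in> borel_measurable lebesgue \<Longrightarrow>
    lorentz_norm_on p q (dyadic_cube j m) (ennreal_maximal g) \<le>
      ennreal C * (SUP k. ennreal (2 powr (- real k * ?n / p)) *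
        (\<Sum>v\<in>?V. lorentz_norm_on p q (dyadic_cube (j - int k) (ancestor k m + v)) g))"
    using lorentz_norm_on_ennreal_maximal_le[OF p q] by blast
  show ?thesis
  proof (intro exI[of _ "C * card ?V"] conjI allI impI)
    fix g :: "real ^ 'n \<Rightarrow> ennreal" assume g: "g \<in> borel_measurable lebesgue"
    let ?a = "\<lambda>j m. lorentz_norm_on p q (dyadic_cube j m) g"
    let ?N = "bml_norm p q t \<infinity> g"
    have a: "ennreal (?W j) * ?a j m \<le> ?N" for j m
      unfolding bml_norm_top_eq by (intro SUP_upper2[of j] SUP_upper2[of m]) auto
    have "ennreal (?W j) * lorentz_norm_on p q (dyadic_cube j m) (ennreal_maximal g)
        \<le> ennreal (C * card ?V) * ?N" for j m
    proof -
      have "ennreal (?W j) * (ennreal (2 powr (- real k * ?n / p)) * (\<Sum>v\<in>?V. ?a (j - int k) (ancestor k m + v)))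
          \<le> ennreal (card ?V) * ?N" for k
      proof -
        have "?W j * 2 powr (- real k * ?n / p) = ?W (j - int k) * 2 powr (- real k * ?n / t)"
          using weight_shift[of j ?n 1 t p k] by simp
        also have "\<dots> \<le> ?W (j - int k) * 2 powr 0"
          using t by (intro mult_left_mono powr_mono) auto
        finally have w: "?W j * 2 powr (- real k * ?n / p) \<le> ?W (j - int k)" by simp
        have "ennreal (?W j) * (ennreal (2 powr (- real k * ?n / p)) * (\<Sum>v\<in>?V. ?a (j - int k) (ancestor k m + v)))
            = ennreal (?W j * 2 powr (- real k * ?n / p)) * (\<Sum>v\<in>?V. ?a (j - int k) (ancestor k m + v))"
          by (rule ennreal_mult_assoc_left) auto
        also have "\<dots> \<le> ennreal (?W (j - int k)) * (\<Sum>v\<in>?V. ?a (j - int k) (ancestor k m + v))"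
          by (intro mult_right_mono ennreal_leI w) simp
        also have "\<dots> = (\<Sum>v\<in>?V. ennreal (?W (j - int k)) * ?a (j - int k) (ancestor k m + v))"
          by (rule sum_distrib_left)
        also have "\<dots> \<le> (\<Sum>v\<in>?V. ?N)" by (intro sum_mono a)
        finally show ?thesis by (simp add: ennreal_of_nat_eq_real_of_nat)
      qed
      then have sup: "ennreal (?W j) * (SUP k. ennreal (2 powr (- real k * ?n / p)) *
        (\<Sum>v\<in>?V. ?a (j - int k) (ancestor k m + v))) \<le> ennreal (card ?V) * ?N"
        unfolding SUP_mult_left_ennreal by (rule SUP_least)
      have "ennreal (?W j) * lorentz_norm_on p q (dyadic_cube j m) (ennreal_maximal g)
         \<le> ennreal (?W j) * (ennreal C * (SUP k. ennreal (2 powr (- real k * ?n / p)) *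
            (\<Sum>v\<in>?V. ?a (j - int k) (ancestor k m + v))))"
        by (intro mult_left_mono le g) simp
      also have "\<dots> = ennreal C * (ennreal (?W j) * (SUP k. ennreal (2 powr (- real k * ?n / p)) *
            (\<Sum>v\<in>?V. ?a (j - int k) (ancestor k m + v))))"
        by (rule mult.left_commute)
      also have "\<dots> \<le> ennreal C * (ennreal (card ?V) * ?N)"
        by (intro mult_left_mono sup) simp
      also have "\<dots> = ennreal (C * card ?V) * ?N"
        using C by (intro ennreal_mult_assoc_left) auto
      finally show ?thesis .
    qed
    then show "bml_norm p q t \<infinity> (ennreal_maximal g) \<le> ennreal (C * card ?V) * ?N"
      by (subst bml_norm_top_eq) (auto intro!: SUP_least)
  qed (use C in simp)
qed

text \<open>Moving the weight gives \<open>2^(-k n \<rho> / t)\<close>, while counting descendants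
  gives \<open>2^(k n)\<close>. Their product is \<open>\<theta>^k\<close>, and
  \<open>\<theta> < 1\<close> exactly because \<open>t < \<rho>\<close>.\<close>

lemma bml_norm_finite_ennreal_maximal_le:
  fixes p t \<rho> :: real and q :: ennreal
  assumes p: "1 < p" and t: "0 < t" "t < \<rho>" and q: "1 \<le> q"
  shows "\<exists>C\<ge>0. \<forall>g :: real ^ 'n \<Rightarrow> ennreal. g \<in> borel_measurable lebesgue \<longrightarrow>
    bml_norm p q t (ennreal \<rho>) (ennreal_maximal g) \<le> ennreal C * bml_norm p q t (ennreal \<rho>) g"
proof -
  let ?n = "CARD('n)"
  let ?V = "unit_offsets :: (int ^ 'n) set"
  let ?W = "\<lambda>j. (2 powr (- real_of_int j * real ?n)) powr (\<rho> / t - \<rho> / p) :: real"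
  let ?cv = "real (card ?V)"
  define \<theta> where "\<theta> = 2 powr (- (?n * (\<rho> / t - 1)))"
  have \<rho>: "0 < \<rho>" using t by simp
  have \<theta>: "0 \<le> \<theta>" "\<theta> < 1"
    using t by (auto simp: \<theta>_def powr_less_one field_simps)
  obtain C where C: "0 \<le> C" and le: "\<And>(g :: real ^ 'n \<Rightarrow> ennreal) j m. g \<in> borel_measurable lebesgue \<Longrightarrow>
    lorentz_norm_on p q (dyadic_cube j m) (ennreal_maximal g) \<le>
      ennreal C * (SUP k. ennreal (2 powr (- real k * ?n / p)) *
        (\<Sum>v\<in>?V. lorentz_norm_on p q (dyadic_cube (j - int k) (ancestor k m + v)) g))"
    using lorentz_norm_on_ennreal_maximal_le[OF p q] by blast
  \<comment> \<open>The factors come from the local estimate, from the power of a sum of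
    \<open>?cv\<close> terms, from the geometric series, and from the number of offsets.\<close>
  define C' where "C' = C powr \<rho> * ?cv powr \<rho> * (1 / (1 - \<theta>) * ?cv)"
  have C': "0 \<le> C'" using \<theta> by (simp add: C'_def)
  show ?thesis
  proof (intro exI[of _ "C' powr (1 / \<rho>)"] conjI allI impI)
    fix g :: "real ^ 'n \<Rightarrow> ennreal" assume g: "g \<in> borel_measurable lebesgue"
    let ?a = "\<lambda>j m. lorentz_norm_on p q (dyadic_cube j m) g"
    let ?b = "\<lambda>j m. lorentz_norm_on p q (dyadic_cube j m) (ennreal_maximal g)"
    let ?B = "\<lambda>j m. ennreal (?W j) * epowr (?a j m) \<rho>"
    let ?T = "\<lambda>k j m. (\<Sum>v\<in>?V. ?B (j - int k) (ancestor k m + v))"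
    let ?w = "\<lambda>k. 2 powr (- real k * ?n * \<rho> / t) :: real"
    define J where "J = (\<integral>\<^sup>+j. \<integral>\<^sup>+m. ?B j m \<partial>count_space UNIV \<partial>count_space UNIV)"
    have pointwise: "ennreal (?W j) * epowr (?b j m) \<rho>
        \<le> ennreal (C powr \<rho> * ?cv powr \<rho>) * (\<Sum>k. ennreal (?w k) * ?T k j m)" for j m
    proof -
      let ?S = "\<lambda>k. \<Sum>v\<in>?V. ?a (j - int k) (ancestor k m + v)"
      let ?x = "\<lambda>k. ennreal (2 powr (- real k * ?n / p)) * ?S k"
      \<comment> \<open>The power of a supremum is at most the sum of the powers, so the sums over
        cubes can be carried out separately for each \<open>k\<close>.\<close>
      have "?x k \<le> epowr (\<Sum>k. epowr (?x k) \<rho>) (1 / \<rho>)" for k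
        using \<rho> by (subst epowr_le_iff[symmetric]) (auto intro: le_suminf_ennreal)
      then have sup: "epowr (SUP k. ?x k) \<rho> \<le> (\<Sum>k. epowr (?x k) \<rho>)"
        using \<rho> by (subst epowr_le_iff) (auto intro: SUP_least)
      have summand: "ennreal (?W j) * epowr (?x k) \<rho> \<le> ennreal (?cv powr \<rho>) * (ennreal (?w k) * ?T k j m)" for k
      proof -
        have "epowr (?x k) \<rho> = ennreal (2 powr (- real k * ?n * \<rho> / p)) * epowr (?S k) \<rho>"
          by (simp add: epowr_mult epowr_ennreal powr_powr)
        also have "\<dots> \<le> ennreal (2 powr (- real k * ?n * \<rho> / p)) *
            (ennreal (?cv powr \<rho>) * (\<Sum>v\<in>?V. epowr (?a (j - int k) (ancestor k m + v)) \<rho>))"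
          using \<rho> by (intro mult_left_mono epowr_sum_le) auto
        finally have "ennreal (?W j) * epowr (?x k) \<rho> \<le> ennreal (?W j) * (ennreal (2 powr (- real k * ?n * \<rho> / p)) *
            (ennreal (?cv powr \<rho>) * (\<Sum>v\<in>?V. epowr (?a (j - int k) (ancestor k m + v)) \<rho>)))"
          by (rule mult_left_mono) simp
        also have "\<dots> = ennreal (?W j * 2 powr (- real k * ?n * \<rho> / p)) *
            (ennreal (?cv powr \<rho>) * (\<Sum>v\<in>?V. epowr (?a (j - int k) (ancestor k m + v)) \<rho>))"
          by (rule ennreal_mult_assoc_left) auto
        also have "\<dots> = ennreal (?W (j - int k) * ?w k) *
            (ennreal (?cv powr \<rho>) * (\<Sum>v\<in>?V. epowr (?a (j - int k) (ancestor k m + v)) \<rho>))"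
          by (simp only: weight_shift)
        also have "\<dots> = ennreal (?cv powr \<rho>) * (ennreal (?w k) *
            (ennreal (?W (j - int k)) * (\<Sum>v\<in>?V. epowr (?a (j - int k) (ancestor k m + v)) \<rho>)))"
          by (simp only: ennreal_mult powr_ge_zero mult_ac)
        finally show ?thesis by (simp only: sum_distrib_left)
      qed
      have "epowr (?b j m) \<rho> \<le> epowr (ennreal C * (SUP k. ?x k)) \<rho>"
        using \<rho> by (intro epowr_mono le g) simp
      also have "\<dots> = ennreal (C powr \<rho>) * epowr (SUP k. ?x k) \<rho>"
        using C by (simp only: epowr_mult epowr_ennreal)
      also have "\<dots> \<le> ennreal (C powr \<rho>) * (\<Sum>k. epowr (?x k) \<rho>)"
        by (intro mult_left_mono sup) simp
      finally have "ennreal (?W j) * epowr (?b j m) \<rho> \<le> ennreal (?W j) * (ennreal (C powr \<rho>) * (\<Sum>k. epowr (?x k) \<rho>))"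
        by (rule mult_left_mono) simp
      also have "\<dots> = ennreal (C powr \<rho>) * (\<Sum>k. ennreal (?W j) * epowr (?x k) \<rho>)"
        by (simp only: ennreal_suminf_cmult mult.left_commute)
      also have "\<dots> \<le> ennreal (C powr \<rho>) * (\<Sum>k. ennreal (?cv powr \<rho>) * (ennreal (?w k) * ?T k j m))"
        by (intro mult_left_mono suminf_le summand) auto
      also have "\<dots> = ennreal (C powr \<rho> * ?cv powr \<rho>) * (\<Sum>k. ennreal (?w k) * ?T k j m)"
        unfolding ennreal_suminf_cmult by (rule ennreal_mult_assoc_left) auto
      finally show ?thesis .
    qed
    have "(\<integral>\<^sup>+j. \<integral>\<^sup>+m. ennreal (?W j) * epowr (?b j m) \<rho> \<partial>count_space UNIV \<partial>count_space UNIV)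
       \<le> (\<integral>\<^sup>+j. \<integral>\<^sup>+m. ennreal (C powr \<rho> * ?cv powr \<rho>) * (\<Sum>k. ennreal (?w k) * ?T k j m) \<partial>count_space UNIV \<partial>count_space UNIV)"
      by (intro nn_integral_mono pointwise)
    also have "\<dots> = ennreal (C powr \<rho> * ?cv powr \<rho>) *
        (\<Sum>k. ennreal (?w k) * (\<integral>\<^sup>+j. \<integral>\<^sup>+m. ?T k j m \<partial>count_space UNIV \<partial>count_space UNIV))"
      by (simp add: nn_integral_cmult nn_integral_suminf)
    also have "(\<Sum>k. ennreal (?w k) * (\<integral>\<^sup>+j. \<integral>\<^sup>+m. ?T k j m \<partial>count_space UNIV \<partial>count_space UNIV))
        = (\<Sum>k. ennreal (\<theta> ^ k) * (ennreal ?cv * J))"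
    proof (rule arg_cong[where f=suminf], rule ext)
      fix k
      have "(\<integral>\<^sup>+j. \<integral>\<^sup>+m. ?T k j m \<partial>count_space UNIV \<partial>count_space UNIV) = ennreal (2 ^ (k * ?n) * ?cv) * J"
        unfolding J_def by (rule nn_integral_ancestor_offsets) simp
      then have "ennreal (?w k) * (\<integral>\<^sup>+j. \<integral>\<^sup>+m. ?T k j m \<partial>count_space UNIV \<partial>count_space UNIV)
         = ennreal (?w k) * (ennreal (2 ^ (k * ?n) * ?cv) * J)" by (simp only:)
      also have "\<dots> = ennreal (?w k * (2 ^ (k * ?n) * ?cv)) * J"
        by (rule ennreal_mult_assoc_left) auto
      also have "?w k * (2 ^ (k * ?n) * ?cv) = \<theta> ^ k * ?cv"
      proof -
        have "\<theta> ^ k = 2 powr (- (?n * (\<rho> / t - 1)) * k)"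
          by (simp add: \<theta>_def powr_powr flip: powr_realpow)
        moreover have "(2::real) ^ (k * ?n) = 2 powr (real k * ?n)"
          by (simp flip: powr_realpow)
        ultimately show ?thesis
          by (simp add: algebra_simps flip: powr_add)
      qed
      also have "ennreal (\<theta> ^ k * ?cv) * J = ennreal (\<theta> ^ k) * (ennreal ?cv * J)"
        using \<theta> by (intro ennreal_mult_assoc_left[symmetric]) auto
      finally show "ennreal (?w k) * (\<integral>\<^sup>+j. \<integral>\<^sup>+m. ?T k j m \<partial>count_space UNIV \<partial>count_space UNIV)
         = ennreal (\<theta> ^ k) * (ennreal ?cv * J)" .
    qed
    also have "\<dots> = ennreal (1 / (1 - \<theta>)) * (ennreal ?cv * J)"
      by (simp only: ennreal_suminf_multc suminf_ennreal_geometric[OF \<theta>])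
    also have "ennreal (C powr \<rho> * ?cv powr \<rho>) * \<dots> = ennreal C' * J"
    proof -
      have "ennreal (1 / (1 - \<theta>)) * (ennreal ?cv * J) = ennreal (1 / (1 - \<theta>) * ?cv) * J"
        using \<theta> by (intro ennreal_mult_assoc_left) auto
      moreover have "ennreal (C powr \<rho> * ?cv powr \<rho>) * (ennreal (1 / (1 - \<theta>) * ?cv) * J) = ennreal C' * J"
        unfolding C'_def using \<theta> by (intro ennreal_mult_assoc_left) auto
      ultimately show ?thesis by (simp only:)
    qed
    finally have "epowr (\<integral>\<^sup>+j. \<integral>\<^sup>+m. ennreal (?W j) * epowr (?b j m) \<rho> \<partial>count_space UNIV \<partial>count_space UNIV) (1 / \<rho>)
       \<le> epowr (ennreal C' * J) (1 / \<rho>)"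
      using \<rho> by (intro epowr_mono) auto
    also have "\<dots> = ennreal (C' powr (1 / \<rho>)) * epowr J (1 / \<rho>)"
      using C' by (simp only: epowr_mult epowr_ennreal)
    finally show "bml_norm p q t (ennreal \<rho>) (ennreal_maximal g) \<le> ennreal (C' powr (1 / \<rho>)) * bml_norm p q t (ennreal \<rho>) g"
      using \<rho> by (simp only: bml_norm_finite_eq less_imp_le J_def)
  qed simp
qed

section \<open>Monotonicity, almost everywhere finiteness and the theorem\<close>

lemma bml_norm_mono:
  fixes g h :: "real ^ 'n \<Rightarrow> ennreal"
  assumes le: "\<And>x. g x \<le> h x"
    and g: "g \<in> borel_measurable lebesgue" and h: "h \<in> borel_measurable lebesgue"
  shows "bml_norm p q t r g \<le> bml_norm p q t r h"
proof -
  have L: "lorentz_norm_on p q Q g \<le> lorentz_norm_on p q Q h" if "Q \<in> dyadic_cubes" for Q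
    unfolding lorentz_norm_on_def using that g h le
    by (intro lorentz_norm_mono borel_measurable_times_ennreal borel_measurable_indicator mult_right_mono)
      (auto simp: dyadic_cubes_def)
  show ?thesis
    unfolding bml_norm_def
    by (auto intro!: SUP_subset_mono epowr_mono infsum_mono nonneg_summable_on_complete mult_left_mono L)
qed

text \<open>The cube contributes a single term to a finite sum or supremum, with a positive
  weight.\<close>

lemma lorentz_norm_on_less_top:
  fixes g :: "real ^ 'n \<Rightarrow> ennreal"
  assumes fin: "bml_norm p q t r g < top" and Q: "Q \<in> dyadic_cubes"
  shows "lorentz_norm_on p q Q g < top"
proof -
  have pos: "0 < measure lebesgue Q"
    using Q by (auto simp: dyadic_cubes_def measure_dyadic_cube)
  show ?thesis
  proof (cases "r = \<infinity>")
    case True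
    have "ennreal (measure lebesgue Q powr (1 / t - 1 / p)) * lorentz_norm_on p q Q g \<le> bml_norm p q t r g"
      unfolding bml_norm_def using True Q by (auto intro: SUP_upper)
    then show ?thesis
      using fin pos by (auto simp: less_top[symmetric] ennreal_mult_top top_unique)
  next
    case False
    let ?F = "\<lambda>Q. ennreal (measure lebesgue Q powr (enn2real r / t - enn2real r / p))
           * epowr (lorentz_norm_on p q Q g) (enn2real r)"
    have "?F Q \<le> (\<integral>\<^sup>+Q. ?F Q \<partial>count_space dyadic_cubes)"
      using Q by (rule nn_integral_ge_point)
    also have "\<dots> < top"
      using fin False
      by (simp add: bml_norm_def infsum_ennreal_eq_nn_integral[OF countable_dyadic_cubes] less_top[symmetric])
    finally show ?thesis
      using pos by (auto simp: less_top[symmetric] ennreal_mult_top)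
  qed
qed

text \<open>On each unit cube the restricted function has finite rearrangement at every
  \<open>u > 0\<close>, so it is infinite on a set of measure at most \<open>u\<close> for all such
  \<open>u\<close>. Countably many unit cubes cover the space. Applied to the maximal function, this
  justifies its real-valued version.\<close>

lemma AE_less_top_of_bml_norm:
  fixes g :: "real ^ 'n \<Rightarrow> ennreal"
  assumes g: "g \<in> borel_measurable lebesgue" and p: "0 < p" and q: "1 \<le> q"
    and fin: "bml_norm p q t r g < top"
  shows "AE x in lebesgue. g x < top"
proof -
  have "AE x in lebesgue. x \<in> dyadic_cube 0 m \<longrightarrow> g x < top" for m :: "int ^ 'n"
  proof -
    let ?h = "\<lambda>x. g x * indicator (dyadic_cube 0 m) x"
    let ?N = "{x. ?h x = top}"
    have h: "?h \<in> borel_measurable lebesgue"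
      using g by (intro borel_measurable_times_ennreal borel_measurable_indicator) auto
    have L: "lorentz_norm p q ?h < top"
      using lorentz_norm_on_less_top[OF fin, of "dyadic_cube 0 m"]
      by (auto simp: lorentz_norm_on_def dyadic_cubes_def)
    have N: "emeasure lebesgue ?N \<le> ennreal u" if u: "0 < u" for u
    proof -
      have "rearrangement ?h u \<le> ennreal (2 powr (1 + 1 / p) * u powr (- 1 / p)) * lorentz_norm p q ?h"
        using u p q by (rule rearrangement_le_lorentz_norm)
      also have "\<dots> < top" using L by (simp add: ennreal_mult_less_top)
      finally have "rearrangement ?h u < top" .
      then have "emeasure lebesgue ?N \<le> emeasure lebesgue {x. rearrangement ?h u < ?h x}"
        by (intro emeasure_mono superlevel_sets h) (auto simp: less_top[symmetric])
      also have "\<dots> \<le> ennreal u" by (rule emeasure_gt_rearrangement[OF h])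
      finally show ?thesis .
    qed
    have "emeasure lebesgue ?N \<le> 0"
      by (rule ennreal_le_epsilon) (simp add: N)
    moreover have "?N \<in> sets lebesgue"
      using borel_measurable_eq[OF h borel_measurable_const[of top]] by simp
    ultimately show ?thesis
      by (intro AE_I'[of ?N]) (auto simp: null_sets_def less_top[symmetric])
  qed
  then have "AE x in lebesgue. \<forall>m :: int ^ 'n. x \<in> dyadic_cube 0 m \<longrightarrow> g x < top"
    by (subst AE_all_countable) blast
  then show ?thesis
  proof eventually_elim
    case (elim x)
    have "x \<in> dyadic_cube 0 (\<chi> i. \<lfloor>x $ i\<rfloor>)" by (simp add: mem_dyadic_cube_iff)
    with elim show ?case by blast
  qed
qed

theorem theorem4p1:
  fixes p t :: real and q r :: ennreal
  assumes "1 \<le> q"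
    and "(1 < p \<and> p < t \<and> ennreal t < r \<and> r < \<infinity>) \<or> (1 < p \<and> p \<le> t \<and> r = \<infinity>)"
  shows "(\<forall>f :: real ^ 'n \<Rightarrow> complex. f \<in> bml_space p q t r \<longrightarrow>
            (AE x in lebesgue. maximal f x < \<infinity>) \<and>
            (\<lambda>x. complex_of_real (enn2real (maximal f x))) \<in> bml_space p q t r)
       \<and> (\<exists>C::real. 0 \<le> C \<and>
            (\<forall>f :: real ^ 'n \<Rightarrow> complex. f \<in> bml_space p q t r \<longrightarrow>
               bml_norm p q t r (maximal f) \<le> ennreal C * bml_norm p q t r (cabs f)))"
proof -
  have p: "1 < p" and t: "0 < t" using assms(2) by auto
  have "\<exists>C\<ge>0. \<forall>g :: real ^ 'n \<Rightarrow> ennreal. g \<in> borel_measurable lebesgue \<longrightarrow>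
    bml_norm p q t r (ennreal_maximal g) \<le> ennreal C * bml_norm p q t r g"
  proof (cases "r = \<infinity>")
    case True
    then show ?thesis using bml_norm_top_ennreal_maximal_le[OF p t assms(1)] by simp
  next
    case False
    then obtain \<rho> where \<rho>: "r = ennreal \<rho>" "0 \<le> \<rho>" by (cases r) auto
    then have "t < \<rho>" using assms(2) t by (auto simp: ennreal_less_iff)
    then show ?thesis using bml_norm_finite_ennreal_maximal_le[OF p t _ assms(1)] \<rho> by simp
  qed
  then obtain C where C: "0 \<le> C" and le: "\<And>g :: real ^ 'n \<Rightarrow> ennreal. g \<in> borel_measurable lebesgue \<Longrightarrow>
    bml_norm p q t r (ennreal_maximal g) \<le> ennreal C * bml_norm p q t r g" by blast
  have cabs: "cabs f \<in> borel_measurable lebesgue" if "f \<in> borel_measurable lebesgue" for f :: "real ^ 'n \<Rightarrow> complex"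
    unfolding cabs_def[abs_def] using that by measurable
  have bound: "bml_norm p q t r (maximal f) \<le> ennreal C * bml_norm p q t r (cabs f)"
    if "f \<in> bml_space p q t r" for f :: "real ^ 'n \<Rightarrow> complex"
    using that unfolding maximal_eq by (intro le cabs) (simp add: bml_space_def)
  have "(AE x in lebesgue. maximal f x < \<infinity>) \<and>
      (\<lambda>x. complex_of_real (enn2real (maximal f x))) \<in> bml_space p q t r"
    if f: "f \<in> bml_space p q t r" for f :: "real ^ 'n \<Rightarrow> complex"
  proof
    have meas [measurable]: "maximal f \<in> borel_measurable lebesgue"
      unfolding maximal_eq by measurable
    let ?f = "\<lambda>x. complex_of_real (enn2real (maximal f x))"
    have f': "?f \<in> borel_measurable lebesgue" by measurable
    have "bml_norm p q t r (cabs f) < top" using f by (simp add: bml_space_def)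
    then have fin: "bml_norm p q t r (maximal f) < top"
      using bound[OF f] by (auto intro: le_less_trans simp: ennreal_mult_less_top)
    then show "AE x in lebesgue. maximal f x < \<infinity>"
      using AE_less_top_of_bml_norm[OF meas _ assms(1), of p t r] p by simp
    \<comment> \<open>Since \<open>enn2real\<close> sends infinity to 0, the inequality holds at
      every point, and monotonicity of the norm applies directly.\<close>
    have "cabs ?f x \<le> maximal f x" for x
      by (cases "maximal f x") (auto simp: cabs_def)
    then have "bml_norm p q t r (cabs ?f) \<le> bml_norm p q t r (maximal f)"
      by (rule bml_norm_mono) (intro cabs f' meas)+
    with fin f' show "?f \<in> bml_space p q t r" by (auto simp: bml_space_def)
  qed
  then show ?thesis using C bound by blast
qed

end
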